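(* Let $X$ be a non-empty set. Then the binary algebra $(\mathfrak{A}(X),\wedge)$ is a model of the free pseudosemilattice generated by $X$, where $x\in X$ is identified with the tree in $\mathfrak{A}(X)$ consisting of a single edge whose two endpoints (the left root and the right root) are both labelled $x$.
   Context: A pseudosemilattice is a set with a binary operation $\wedge$ satisfying the identities (PS1) $x\wedge x\approx x$; (PS2) $(x\wedge y)\wedge(x\wedge z)\approx(x\wedge y)\wedge z$; (PS3) $((x\wedge y)\wedge(x\wedge z))\wedge(x\wedge w)\approx(x\wedge y)\wedge((x\wedge z)\wedge(x\wedge w))$; and the left-right duals (PS2') $(z\wedge x)\wedge(y\wedge x)\approx z\wedge(y\wedge x)$ and (PS3') $(w\wedge x)\wedge((z\wedge x)\wedge(y\wedge x))\approx((w\wedge x)\wedge(z\wedge x))\wedge(y\wedge x)$. Trees below are considered up to isomorphism preserving labels and roots. $\mathfrak{B}'(X)$ is the set of finite trees $\gamma$ with at least two vertices, each vertex labelled by an element of $X$, together with a distinguished ordered pair $(\mathfrak{l}_\gamma,\mathfrak{r}_\gamma)$ of two distinct adjacent vertices, the left root and the right root. Vertices at even distance from $\mathfrak{l}_\gamma$ are called left vertices, those at odd distance right vertices. $\mathfrak{B}(X)=\mathfrak{B}'(X)\cup X$, where a letter $x$ is viewed as the one-vertex graph labelled $x$, its vertex serving as both $\mathfrak{l}$ and $\mathfrak{r}$. For $\alpha,\beta\in\mathfrak{B}(X)$, $\alpha\sqcap\beta\in\mathfrak{B}'(X)$ is obtained from the disjoint union of $\alpha$ and $\beta$ by adding a new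 edge joining $\mathfrak{l}_\alpha$ and $\mathfrak{r}_\beta$, and taking $\mathfrak{l}_\alpha$ as left root and $\mathfrak{r}_\beta$ as right root. A thorn of $\alpha\in\mathfrak{B}'(X)$ is a pair $\{e,a\}$ where $a$ is a vertex of degree 1, $e$ is the unique edge at $a$, and the two endpoints of $e$ have the same label; it is essential if $a$ is one of the two roots, and non-essential otherwise. Reduction rules on $\mathfrak{B}'(X)$: (i) deletion of a thorn: remove a non-essential thorn $\{e,a\}$; (ii) edge-folding: if two edges $e\neq f$ share a vertex and their other endpoints $a\ne b$ have the same label, identify $e$ with $f$ and $a$ with $b$ (keeping the label; if one of the merged vertices is a root then so is the resulting vertex). Applying rules in any order until no more apply yields a unique reduced form $\overline{\alpha}$. For $\alpha=x\in X$, $\overline{\alpha}$ is the single-edge tree with both vertices labelled $x$. $\mathfrak{A}(X)$ is the set of all reduced members of $\mathfrak{B}'(X)$, with operation $\alpha\wedge\beta:=\overline{\alpha\sqcap\beta}$. *)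

theory Defs
  imports Main "HOL-Library.FuncSet" "HOL-Library.Nat_Bijection"
begin

locale pseudosemilattice =
  fixes S :: "'b set" and mult :: "'b \<Rightarrow> 'b \<Rightarrow> 'b"  (infixl "\<cdot>" 70)
  assumes closed: "\<lbrakk>x \<in> S; y \<in> S\<rbrakk> \<Longrightarrow> x \<cdot> y \<in> S"
    and PS1: "x \<in> S \<Longrightarrow> x \<cdot> x = x"
    and PS2: "\<lbrakk>x \<in> S; y \<in> S; z \<in> S\<rbrakk> \<Longrightarrow> (x \<cdot> y) \<cdot> (x \<cdot> z) = (x \<cdot> y) \<cdot> z"
    and PS3: "\<lbrakk>x \<in> S; y \<in> S; z \<in> S; w \<in> S\<rbrakk> \<Longrightarrow>
      ((x \<cdot> y) \<cdot> (x \<cdot> z)) \<cdot> (x \<cdot> w) = (x \<cdot> y) \<cdot> ((x \<cdot> z) \<cdot> (x \<cdot> w))"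
    and PS2': "\<lbrakk>x \<in> S; y \<in> S; z \<in> S\<rbrakk> \<Longrightarrow> (z \<cdot> x) \<cdot> (y \<cdot> x) = z \<cdot> (y \<cdot> x)"
    and PS3': "\<lbrakk>x \<in> S; y \<in> S; z \<in> S; w \<in> S\<rbrakk> \<Longrightarrow>
      (w \<cdot> x) \<cdot> ((z \<cdot> x) \<cdot> (y \<cdot> x)) = ((w \<cdot> x) \<cdot> (z \<cdot> x)) \<cdot> (y \<cdot> x)"

text \<open>
  A record is a concrete tree; every finite tree has a copy whose vertices are natural numbers.
  The values of \<open>lab\<close> outside \<open>verts\<close> are irrelevant, and isomorphism ignores them.
\<close>

record 'a btree =
  verts :: "nat set"
  edges :: "nat set set"
  lab   :: "nat \<Rightarrow> 'a"
  lroot :: nat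
  rroot :: nat

definition adj :: "'a btree \<Rightarrow> nat \<Rightarrow> nat \<Rightarrow> bool" where
  "adj t u v \<longleftrightarrow> {u, v} \<in> edges t"

definition is_cycle :: "'a btree \<Rightarrow> nat list \<Rightarrow> bool" where
  "is_cycle t vs \<longleftrightarrow> length vs \<ge> 3 \<and> distinct vs \<and> successively (adj t) vs \<and> adj t (last vs) (hd vs)"

definition finite_tree :: "'a btree \<Rightarrow> bool" where
  "finite_tree t \<longleftrightarrow>
     finite (verts t) \<and> verts t \<noteq> {} \<and>
     (\<forall>e \<in> edges t. e \<subseteq> verts t \<and> card e = 2) \<and>
     (\<forall>u \<in> verts t. \<forall>v \<in> verts t. (adj t)\<^sup>*\<^sup>* u v) \<and>
     (\<nexists>vs. is_cycle t vs)"

text \<open>The members of \<open>\<BB>'(X)\<close>, before passing to isomorphism classes.\<close>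

definition birooted_trees :: "'a set \<Rightarrow> 'a btree set" where
  "birooted_trees X = {t. finite_tree t \<and> card (verts t) \<ge> 2 \<and> lab t ` verts t \<subseteq> X \<and>
     lroot t \<in> verts t \<and> rroot t \<in> verts t \<and> lroot t \<noteq> rroot t \<and> adj t (lroot t) (rroot t)}"

definition tree_iso :: "'a btree rel" where
  "tree_iso = {(s, t). \<exists>\<phi>. bij_betw \<phi> (verts s) (verts t) \<and>
     edges t = (\<lambda>e. \<phi> ` e) ` edges s \<and>
     (\<forall>v \<in> verts s. lab t (\<phi> v) = lab s v) \<and>
     \<phi> (lroot s) = lroot t \<and> \<phi> (rroot s) = rroot t}"

definition iso_class :: "'a btree \<Rightarrow> 'a btree set" where
  "iso_class t = tree_iso `` {t}"

definition join :: "'a btree \<Rightarrow> 'a btree \<Rightarrow> 'a btree"  (infixl "\<sqinter>\<^sub>T" 70) where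
  "s \<sqinter>\<^sub>T t = (let il = \<lambda>v. sum_encode (Inl v); ir = \<lambda>v. sum_encode (Inr v) in
     \<lparr> verts = il ` verts s \<union> ir ` verts t,
       edges = (\<lambda>e. il ` e) ` edges s \<union> (\<lambda>e. ir ` e) ` edges t \<union> {{il (lroot s), ir (rroot t)}},
       lab = (\<lambda>n. case sum_decode n of Inl v \<Rightarrow> lab s v | Inr v \<Rightarrow> lab t v),
       lroot = il (lroot s),
       rroot = ir (rroot t) \<rparr>)"

definition degree :: "'a btree \<Rightarrow> nat \<Rightarrow> nat" where
  "degree t a = card {e \<in> edges t. a \<in> e}"

definition thorn :: "'a btree \<Rightarrow> nat set \<Rightarrow> nat \<Rightarrow> bool" where
  "thorn t e a \<longleftrightarrow> a \<in> verts t \<and> degree t a = 1 \<and> e \<in> edges t \<and> (\<exists>c. e = {a, c} \<and> lab t a = lab t c)"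

definition essential :: "'a btree \<Rightarrow> nat \<Rightarrow> bool" where
  "essential t a \<longleftrightarrow> a = lroot t \<or> a = rroot t"

definition delete_thorn :: "'a btree \<Rightarrow> nat set \<Rightarrow> nat \<Rightarrow> 'a btree" where
  "delete_thorn t e a = t\<lparr>verts := verts t - {a}, edges := edges t - {e}\<rparr>"

text \<open>
  The merged vertex keeps the name \<open>a\<close>. Taking the image of the edge set under the
  identification also merges the two folded edges \<open>{c, a}\<close> and \<open>{c, b}\<close>.
\<close>

definition merge :: "'a btree \<Rightarrow> nat \<Rightarrow> nat \<Rightarrow> 'a btree" where
  "merge t a b = (let \<pi> = id(b := a) in
     t\<lparr>verts := \<pi> ` verts t, edges := (\<lambda>e. \<pi> ` e) ` edges t,
       lroot := \<pi> (lroot t), rroot := \<pi> (rroot t)\<rparr>)"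

inductive reduces :: "'a btree \<Rightarrow> 'a btree \<Rightarrow> bool" where
  thorn_deletion: "\<lbrakk>thorn t e a; \<not> essential t a\<rbrakk> \<Longrightarrow> reduces t (delete_thorn t e a)"
| edge_folding: "\<lbrakk>{c, a} \<in> edges t; {c, b} \<in> edges t; a \<noteq> b; lab t a = lab t b\<rbrakk> \<Longrightarrow>
    reduces t (merge t a b)"

definition reduced :: "'a btree \<Rightarrow> bool" where
  "reduced t \<longleftrightarrow> (\<nexists>u. reduces t u)"

text \<open>The reduced form is unique only up to isomorphism, hence it is a class.\<close>

definition reduced_form :: "'a btree \<Rightarrow> 'a btree set" where
  "reduced_form t = (THE C. \<exists>u. reduces\<^sup>*\<^sup>* t u \<and> reduced u \<and> C = iso_class u)"

definition reduced_trees :: "'a set \<Rightarrow> 'a btree set set"  ("\<AA>") where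
  "\<AA> X = {iso_class t | t. t \<in> birooted_trees X \<and> reduced t}"

text \<open>
  As usual for operations on quotients, the union is over the results for all representatives;
  all of these results are the same class.
\<close>

definition wedge :: "'a btree set \<Rightarrow> 'a btree set \<Rightarrow> 'a btree set"  (infixl "\<and>\<^sub>T" 70) where
  "A \<and>\<^sub>T B = (\<Union>s \<in> A. \<Union>t \<in> B. reduced_form (s \<sqinter>\<^sub>T t))"

definition letter :: "'a \<Rightarrow> 'a btree set" where
  "letter x = iso_class \<lparr>verts = {0, 1}, edges = {{0, 1}}, lab = (\<lambda>_. x), lroot = 0, rroot = 1\<rparr>"

end

theory Submission
  imports Defs
begin

text \<open>
  The proof maps trees into \<^emph>\<open>folded graphs\<close>: labelled graphs in which a vertex has at most one
  neighbour of each label, and every vertex has a neighbour with its own label. Such a graph cannot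
  tell a tree from its reductions. A morphism into it must agree on two vertices that can be folded,
  and it extends to a deleted thorn in exactly one way. A morphism is therefore recorded by the
  images of the two roots and by its image closed under neighbours of equal label, and the set
  \<open>sem t\<close> of all these records depends only on the class of \<open>t\<close> under reduction and isomorphism
  (\<open>sem_reduces\<close>, \<open>sem_iso\<close>). The operation on trees becomes a product of such sets, in which two
  morphisms are glued along the new root edge (\<open>sem_join\<close>). For this product the identities of
  pseudosemilattices are immediate: the copies of one tree that occur in an identity have their
  roots attached to one common vertex, and since a morphism is determined by the image of one root,
  the copies coincide.

  Two folded graphs are used. The first is the universal one, a tree whose vertices are the words
  without backtracking. A reduced tree embeds there, and it can be recovered from its closed image
  (\<open>reduced_iso\<close>). Hence \<open>sem\<close> separates reduced trees, so reduced forms are unique,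
  and the algebra of reduced trees inherits the identities (\<open>reduced_trees_pseudosemilattice\<close>).

  The second is built from a pseudosemilattice \<open>S\<close> and a map \<open>f\<close> from the letters to \<open>S\<close>: an element
  \<open>g\<close> that is absorbed by \<open>f x\<close> on the left and by \<open>f y\<close> on the right is an edge between vertices
  labelled \<open>x\<close> and \<open>y\<close>. The possible images of the root edge of a tree are exactly the elements below
  one element of \<open>S\<close>. This is the value of the tree. Values turn joins into products
  (\<open>has_value_join\<close>) and are not affected by reduction, so they define the required homomorphism. It
  is unique because cutting the root edge again and again shows that letters generate the algebra
  (\<open>reduced_trees_generated\<close>).
\<close>

section \<open>Finite trees and bridges\<close>

text \<open>
  Acyclicity is used in the form that every edge is a bridge. It then speaks about reachability only,
  which is easy to transport along the maps that merge, delete or glue vertices.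
\<close>

definition reach :: "nat set set \<Rightarrow> nat \<Rightarrow> nat \<Rightarrow> bool" where
  "reach E = (\<lambda>x y. {x, y} \<in> E)\<^sup>*\<^sup>*"

lemma reach_refl [simp, intro]: "reach E u u"
  by (simp add: reach_def)

lemma reach_edge: "{u, v} \<in> E \<Longrightarrow> reach E u v"
  unfolding reach_def by (rule r_into_rtranclp)

lemma reach_trans [trans]: "reach E u v \<Longrightarrow> reach E v w \<Longrightarrow> reach E u w"
  unfolding reach_def by (rule rtranclp_trans)

lemma reach_sym: "reach E u v \<Longrightarrow> reach E v u"
proof -
  have "symp (\<lambda>x y. {x, y} \<in> E)" by (auto intro!: sympI simp: insert_commute)
  then show "reach E u v \<Longrightarrow> reach E v u"
    unfolding reach_def by (metis symp_rtranclp sympD)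
qed

lemma reach_induct [consumes 1, case_names base step]:
  assumes "reach E u v" "P u" "\<And>x y. reach E u x \<Longrightarrow> {x, y} \<in> E \<Longrightarrow> P x \<Longrightarrow> P y"
  shows "P v"
  using assms(1) unfolding reach_def
  by (induction rule: rtranclp_induct) (use assms(2,3) in \<open>auto simp: reach_def\<close>)

lemma reach_image:
  assumes "reach E u v" "\<And>x y. {x, y} \<in> E \<Longrightarrow> reach F (f x) (f y)"
  shows "reach F (f u) (f v)"
  using assms(1)
  by (induction rule: reach_induct) (use assms(2) in \<open>auto intro: reach_trans\<close>)

lemma reach_mono: "reach E u v \<Longrightarrow> E \<subseteq> F \<Longrightarrow> reach F u v"
  using reach_image[of E u v F id] by (auto intro: reach_edge)

definition is_tree :: "nat set \<Rightarrow> nat set set \<Rightarrow> bool" where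
  "is_tree V E \<longleftrightarrow> finite V \<and> V \<noteq> {} \<and> (\<forall>e \<in> E. e \<subseteq> V \<and> card e = 2)
    \<and> (\<forall>u \<in> V. \<forall>v \<in> V. reach E u v)
    \<and> (\<forall>u v. {u, v} \<in> E \<longrightarrow> \<not> reach (E - {{u, v}}) u v)"

lemma simple_path:
  assumes "R\<^sup>*\<^sup>* u v"
  shows "\<exists>vs. vs \<noteq> [] \<and> hd vs = u \<and> last vs = v \<and> distinct vs \<and> successively R vs"
  using assms
proof (induction rule: rtranclp_induct)
  case base
  show ?case by (rule exI[of _ "[u]"]) simp
next
  case (step y z)
  then obtain vs where vs: "vs \<noteq> []" "hd vs = u" "last vs = y" "distinct vs" "successively R vs"
    by blast
  show ?case
  proof (cases "z \<in> set vs")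
    case True
    then obtain ys zs where "vs = ys @ z # zs" by (meson split_list)
    with vs show ?thesis
      by (intro exI[of _ "ys @ [z]"]) (auto simp: successively_append_iff hd_append)
  next
    case False
    with vs step.hyps show ?thesis
      by (intro exI[of _ "vs @ [z]"]) (auto simp: successively_append_iff)
  qed
qed

lemma successively_reach: "successively R vs \<Longrightarrow> vs \<noteq> [] \<Longrightarrow> R\<^sup>*\<^sup>* (hd vs) (last vs)"
  by (induction vs rule: induct_list012) (auto intro: converse_rtranclp_into_rtranclp)

lemma cycle_iff_not_bridge:
  assumes "\<forall>e \<in> edges t. card e = 2"
  shows "(\<exists>vs. is_cycle t vs) \<longleftrightarrow>
    (\<exists>u v. {u, v} \<in> edges t \<and> reach (edges t - {{u, v}}) u v)"
proof
  assume "\<exists>vs. is_cycle t vs"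
  then obtain vs where vs: "length vs \<ge> 3" "distinct vs" "successively (adj t) vs"
      "adj t (last vs) (hd vs)"
    unfolding is_cycle_def by blast
  define n where "n = length vs"
  have ne: "vs \<noteq> []" using vs(1) by auto
  let ?e = "{hd vs, last vs}"
  have "{vs ! i, vs ! Suc i} \<noteq> ?e" if i: "Suc i < n" for i
  proof
    assume "{vs ! i, vs ! Suc i} = ?e"
    then have "{vs ! i, vs ! Suc i} = {vs ! 0, vs ! (n - 1)}"
      using ne by (simp add: hd_conv_nth last_conv_nth n_def)
    then show False
      using i vs(1,2) ne unfolding n_def
      by (auto simp: doubleton_eq_iff nth_eq_iff_index_eq)
  qed
  then have "successively (\<lambda>x y. {x, y} \<in> edges t - {?e}) vs"
    using vs(3) by (auto simp: successively_conv_nth adj_def n_def)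
  then have "reach (edges t - {?e}) (hd vs) (last vs)"
    unfolding reach_def using ne by (rule successively_reach)
  moreover have "?e \<in> edges t"
    using vs(4) by (simp add: adj_def insert_commute)
  ultimately show "\<exists>u v. {u, v} \<in> edges t \<and> reach (edges t - {{u, v}}) u v"
    by blast
next
  assume "\<exists>u v. {u, v} \<in> edges t \<and> reach (edges t - {{u, v}}) u v"
  then obtain u v where uv: "{u, v} \<in> edges t" "reach (edges t - {{u, v}}) u v"
    by blast
  from simple_path[OF uv(2)[unfolded reach_def]] obtain vs where vs: "vs \<noteq> []" "hd vs = u"
      "last vs = v" "distinct vs" "successively (\<lambda>x y. {x, y} \<in> edges t - {{u, v}}) vs"
    by blast
  have "u \<noteq> v" using uv(1) assms by auto
  have "length vs \<ge> 3"
  proof (rule ccontr)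
    assume "\<not> length vs \<ge> 3"
    then have "length vs = 1 \<or> length vs = 2"
      using vs(1) length_0_conv[of vs] by linarith
    then show False
      using vs \<open>u \<noteq> v\<close> by (auto simp: length_Suc_conv numeral_2_eq_2)
  qed
  moreover have "successively (adj t) vs"
    using vs(5) by (rule successively_mono) (auto simp: adj_def)
  ultimately have "is_cycle t vs"
    using vs uv(1) by (auto simp: is_cycle_def adj_def insert_commute)
  then show "\<exists>vs. is_cycle t vs" by blast
qed

lemma finite_tree_iff: "finite_tree t \<longleftrightarrow> is_tree (verts t) (edges t)"
proof -
  have "adj t = (\<lambda>u v. {u, v} \<in> edges t)" by (intro ext) (simp add: adj_def)
  then show ?thesis
    unfolding finite_tree_def is_tree_def reach_def[symmetric]
    using cycle_iff_not_bridge[of t] by (auto simp: reach_def)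
qed

lemma is_treeD:
  assumes "is_tree V E"
  shows "finite V" "V \<noteq> {}" "{u, v} \<in> E \<Longrightarrow> u \<in> V" "{u, v} \<in> E \<Longrightarrow> v \<in> V"
    "{u, v} \<in> E \<Longrightarrow> u \<noteq> v" "u \<in> V \<Longrightarrow> v \<in> V \<Longrightarrow> reach E u v"
    "{u, v} \<in> E \<Longrightarrow> \<not> reach (E - {{u, v}}) u v"
  using assms unfolding is_tree_def by force+

lemma is_tree_edgeE:
  assumes "is_tree V E" "e \<in> E"
  obtains u v where "e = {u, v}" "u \<noteq> v" "u \<in> V" "v \<in> V"
  using assms unfolding is_tree_def by (metis card_2_iff insert_subset)

lemma is_tree_image:
  assumes t: "is_tree V E" and inj: "inj_on f V"
  shows "is_tree (f ` V) ((`) f ` E)"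
  unfolding is_tree_def
proof (intro conjI ballI allI impI)
  show "finite (f ` V)" "f ` V \<noteq> {}" using is_treeD(1,2)[OF t] by auto
next
  fix e assume "e \<in> (`) f ` E"
  then obtain d where d: "d \<in> E" "e = f ` d" by blast
  then obtain u v where "d = {u, v}" "u \<noteq> v" "u \<in> V" "v \<in> V"
    by (meson is_tree_edgeE t)
  with d inj show "e \<subseteq> f ` V" "card e = 2"
    by (auto simp: inj_on_eq_iff)
next
  fix u v assume "u \<in> f ` V" "v \<in> f ` V"
  then obtain x y where "x \<in> V" "y \<in> V" "u = f x" "v = f y" by blast
  then have "reach E x y" using is_treeD(6)[OF t] by blast
  then show "reach ((`) f ` E) u v"
    unfolding \<open>u = f x\<close> \<open>v = f y\<close>
  proof (rule reach_image)
    fix m n assume "{m, n} \<in> E"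
    then have "f ` {m, n} \<in> (`) f ` E" by (rule imageI)
    then show "reach ((`) f ` E) (f m) (f n)" by (simp add: reach_edge)
  qed
next
  fix u v assume "{u, v} \<in> (`) f ` E"
  then obtain d where d: "d \<in> E" "{u, v} = f ` d" by blast
  obtain m n where mn: "d = {m, n}" "m \<in> V" "n \<in> V"
    by (meson is_tree_edgeE t d(1))
  have "{u, v} = {f m, f n}" using d(2) mn(1) by simp
  then have "u = f m \<and> v = f n \<or> u = f n \<and> v = f m" by (simp add: doubleton_eq_iff)
  then obtain x y where xy: "{x, y} \<in> E" "u = f x" "v = f y" "x \<in> V" "y \<in> V"
    using d(1) mn by (metis insert_commute)
  let ?g = "inv_into V f"
  have g: "?g (f z) = z" if "z \<in> V" for z using that inj by simp
  show "\<not> reach ((`) f ` E - {{u, v}}) u v"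
  proof
    assume "reach ((`) f ` E - {{u, v}}) u v"
    then have "reach (E - {{x, y}}) (?g u) (?g v)"
    proof (rule reach_image)
      fix p q assume "{p, q} \<in> (`) f ` E - {{u, v}}"
      then obtain d where d: "d \<in> E" "{p, q} = f ` d" "f ` d \<noteq> {u, v}" by blast
      then obtain m n where mn: "d = {m, n}" "m \<in> V" "n \<in> V"
        by (meson is_tree_edgeE t)
      have "d \<noteq> {x, y}" using d(3) xy by auto
      with d mn have "{m, n} \<in> E - {{x, y}}" by auto
      then have "reach (E - {{x, y}}) m n" by (rule reach_edge)
      moreover from this have "reach (E - {{x, y}}) n m" by (rule reach_sym)
      moreover have "p = f m \<and> q = f n \<or> p = f n \<and> q = f m"
        using d(2) mn by (auto simp: doubleton_eq_iff)
      ultimately show "reach (E - {{x, y}}) (?g p) (?g q)"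
        using g mn by auto
    qed
    then show False
      using g xy is_treeD(7)[OF t xy(1)] by simp
  qed
qed

lemma bridge_disjoint_union:
  assumes t1: "is_tree V1 E1" and t2: "is_tree V2 E2" and disj: "V1 \<inter> V2 = {}"
    and ab: "a \<in> V1" "b \<in> V2" and uv: "{u, v} \<in> E1"
  shows "\<not> reach (E1 \<union> E2 \<union> {{a, b}} - {{u, v}}) u v"
proof
  \<comment> \<open>collapsing the second tree to \<open>a\<close> turns any detour into one inside the first tree\<close>
  let ?f = "\<lambda>x. if x \<in> V1 then x else a"
  assume "reach (E1 \<union> E2 \<union> {{a, b}} - {{u, v}}) u v"
  then have "reach (E1 - {{u, v}}) (?f u) (?f v)"
  proof (rule reach_image)
    fix x y assume "{x, y} \<in> E1 \<union> E2 \<union> {{a, b}} - {{u, v}}"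
    then consider "{x, y} \<in> E1 - {{u, v}}" | "{x, y} \<in> E2" | "{x, y} = {a, b}" by blast
    then show "reach (E1 - {{u, v}}) (?f x) (?f y)"
    proof cases
      case 1
      then have "x \<in> V1" "y \<in> V1" using is_treeD(3,4)[OF t1] by auto
      with 1 show ?thesis by (simp add: reach_edge)
    next
      case 2
      then have "x \<in> V2" "y \<in> V2" using is_treeD(3,4)[OF t2] by auto
      with disj show ?thesis by auto
    next
      case 3
      with ab disj show ?thesis by (auto simp: doubleton_eq_iff)
    qed
  qed
  moreover have "u \<in> V1" "v \<in> V1" using is_treeD(3,4)[OF t1 uv] by auto
  ultimately show False
    using is_treeD(7)[OF t1 uv] by simp
qed

text \<open>
  A detour around the new edge would have to use the new edge to change sides.
\<close>

lemma is_tree_disjoint_union: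
  assumes t1: "is_tree V1 E1" and t2: "is_tree V2 E2" and disj: "V1 \<inter> V2 = {}"
    and ab: "a \<in> V1" "b \<in> V2"
  shows "is_tree (V1 \<union> V2) (E1 \<union> E2 \<union> {{a, b}})"
proof -
  let ?E = "E1 \<union> E2 \<union> {{a, b}}"
  have ne: "a \<noteq> b" using ab disj by auto
  have edges: "\<forall>e \<in> ?E. e \<subseteq> V1 \<union> V2 \<and> card e = 2"
    using t1 t2 ab ne unfolding is_tree_def by auto
  have to_a: "reach ?E x a" if "x \<in> V1 \<union> V2" for x
    using that
  proof
    assume "x \<in> V1"
    then have "reach E1 x a" using is_treeD(6)[OF t1] ab by blast
    then show ?thesis by (rule reach_mono) blast
  next
    assume "x \<in> V2"
    then have "reach E2 x b" using is_treeD(6)[OF t2] ab by blast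
    then have "reach ?E x b" by (rule reach_mono) blast
    also have "reach ?E b a" by (rule reach_edge) (auto simp: insert_commute)
    finally show ?thesis .
  qed
  have bridges: "\<not> reach (?E - {{u, v}}) u v" if uv: "{u, v} \<in> ?E" for u v
  proof -
    consider "{u, v} \<in> E1" | "{u, v} \<in> E2" | "{u, v} = {a, b}"
      using uv by blast
    then show ?thesis
    proof cases
      case 1
      then show ?thesis using bridge_disjoint_union[OF t1 t2 disj ab] by blast
    next
      case 2
      have "V2 \<inter> V1 = {}" using disj by blast
      from bridge_disjoint_union[OF t2 t1 this ab(2,1) 2] show ?thesis
        by (simp add: insert_commute Un_commute)
    next
      case 3
      have "\<not> reach (E1 \<union> E2) a b"
      proof
        assume "reach (E1 \<union> E2) a b"
        then have "b \<in> V1"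
        proof (induction rule: reach_induct)
          case (step x y)
          then show ?case using disj is_treeD(3,4)[OF t1] is_treeD(3,4)[OF t2] by blast
        qed (rule ab)
        then show False using ab disj by blast
      qed
      moreover have "?E - {{u, v}} = E1 \<union> E2"
        using 3 is_treeD(4)[OF t1, of a b] is_treeD(3)[OF t2, of a b] ab disj by auto
      moreover have "u = a \<and> v = b \<or> u = b \<and> v = a"
        using 3 by (simp add: doubleton_eq_iff)
      ultimately show ?thesis
        using reach_sym by metis
    qed
  qed
  have con: "reach ?E u v" if "u \<in> V1 \<union> V2" "v \<in> V1 \<union> V2" for u v
    using to_a[OF that(1)] reach_sym[OF to_a[OF that(2)]] by (rule reach_trans)
  have "finite (V1 \<union> V2)" "V1 \<union> V2 \<noteq> {}"
    using is_treeD(1,2)[OF t1] is_treeD(1)[OF t2] by auto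
  then show ?thesis
    unfolding is_tree_def using edges con bridges by blast
qed

lemma leaf_edge_unique:
  assumes "card {e \<in> E. a \<in> e} = 1" "d \<in> E" "a \<in> d" "d' \<in> E" "a \<in> d'"
  shows "d = d'"
proof -
  obtain c where "{e \<in> E. a \<in> e} = {c}" using assms(1) by (rule card_1_singletonE)
  moreover have "d \<in> {e \<in> E. a \<in> e}" "d' \<in> {e \<in> E. a \<in> e}" using assms by auto
  ultimately show ?thesis by simp
qed

lemma is_tree_delete_leaf:
  assumes t: "is_tree V E" and deg: "card {e \<in> E. a \<in> e} = 1" and ac: "{a, c} \<in> E"
  shows "is_tree (V - {a}) (E - {{a, c}})"
proof -
  have only: "e = {a, c}" if "e \<in> E" "a \<in> e" for e
    using leaf_edge_unique[OF deg that ac] by simp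
  have "a \<noteq> c" "c \<in> V" using is_treeD(4,5)[OF t ac] by auto
  have con: "reach (E - {{a, c}}) u v" if "u \<in> V - {a}" "v \<in> V - {a}" for u v
  proof -
    \<comment> \<open>retracting the leaf to its neighbour turns a path into one that avoids the leaf\<close>
    let ?f = "\<lambda>x. if x = a then c else x"
    have "reach E u v" using is_treeD(6)[OF t] that by blast
    then have "reach (E - {{a, c}}) (?f u) (?f v)"
    proof (rule reach_image)
      fix x y assume xy: "{x, y} \<in> E"
      show "reach (E - {{a, c}}) (?f x) (?f y)"
      proof (cases "a \<in> {x, y}")
        case True
        then have "{x, y} = {a, c}" using only xy by blast
        then show ?thesis by (auto simp: doubleton_eq_iff)
      next
        case False
        then show ?thesis using xy by (auto intro!: reach_edge)
      qed
    qed
    then show ?thesis using that by simp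
  qed
  have "\<not> reach (E - {{a, c}} - {{u, v}}) u v" if "{u, v} \<in> E - {{a, c}}" for u v
    using is_treeD(7)[OF t, of u v] that reach_mono[of "E - {{a, c}} - {{u, v}}" u v "E - {{u, v}}"]
    by blast
  moreover have "e \<subseteq> V - {a} \<and> card e = 2" if "e \<in> E - {{a, c}}" for e
    using that only t unfolding is_tree_def by blast
  ultimately show ?thesis
    unfolding is_tree_def using con is_treeD(1)[OF t] \<open>a \<noteq> c\<close> \<open>c \<in> V\<close> by auto
qed

text \<open>
  Folding keeps every edge a bridge, because a detour in the quotient lifts to a detour in the original
  tree, once a jump from \<open>a\<close> to \<open>b\<close> is read as the path through \<open>c\<close>. For the folded edge itself this
  path is not available, and the lift is followed from \<open>c\<close> instead.
\<close>

lemma is_tree_merge: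
  assumes t: "is_tree V E" and ca: "{c, a} \<in> E" and cb: "{c, b} \<in> E" and ab: "a \<noteq> b"
  shows "is_tree (id(b := a) ` V) ((`) (id(b := a)) ` E)"
proof -
  define p where "p = id(b := a)"
  have pa: "p a = a" and pb: "p b = a" and px: "\<And>x. x \<noteq> b \<Longrightarrow> p x = x"
    using ab unfolding p_def by auto
  let ?E = "(`) p ` E"
  have ne: "c \<noteq> a" "c \<noteq> b" using is_treeD(5)[OF t] ca cb by auto
  have pc: "p c = c" using ne px by blast
  have nab: "{a, b} \<notin> E"
  proof
    assume e: "{a, b} \<in> E"
    have "{a, c} \<in> E - {{a, b}}" "{c, b} \<in> E - {{a, b}}"
      using ca cb ne ab by (auto simp: insert_commute doubleton_eq_iff)
    then have "reach (E - {{a, b}}) a b" by (meson reach_edge reach_trans)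
    with is_treeD(7)[OF t e] show False by simp
  qed
  have fib: "x = y \<or> {x, y} = {a, b}" if "p x = p y" for x y
    using that pa pb px by (metis insert_commute)
  have edges: "e \<subseteq> p ` V \<and> card e = 2" if "e \<in> ?E" for e
  proof -
    obtain d where d: "d \<in> E" "e = p ` d" using \<open>e \<in> ?E\<close> by blast
    then obtain u v where uv: "d = {u, v}" "u \<noteq> v" "u \<in> V" "v \<in> V"
      by (meson is_tree_edgeE t)
    have "p u \<noteq> p v" using fib[of u v] uv(1,2) d(1) nab by metis
    then show ?thesis unfolding d(2) uv(1) using uv(3,4) by simp
  qed
  have push: "{p m, p n} \<in> ?E" if "{m, n} \<in> E" for m n
    using imageI[OF that, of "(`) p"] by simp
  have con: "reach ?E u v" if uv: "u \<in> p ` V" "v \<in> p ` V" for u v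
  proof -
    obtain x y where xy: "x \<in> V" "y \<in> V" "u = p x" "v = p y" using uv by blast
    have "reach E x y" using is_treeD(6)[OF t] xy by blast
    then show ?thesis
      unfolding xy(3,4) by (rule reach_image) (rule reach_edge, rule push)
  qed
  have lift: "\<exists>m n. {m, n} \<in> E \<and> p m = x \<and> p n = y" if xy: "{x, y} \<in> ?E" for x y
  proof -
    obtain d where d: "d \<in> E" "{x, y} = p ` d" using xy by blast
    then obtain u v where uv: "d = {u, v}" by (meson is_tree_edgeE t)
    with d have "{u, v} \<in> E" "{v, u} \<in> E" "{x, y} = {p u, p v}"
      by (simp_all add: insert_commute)
    then show ?thesis by (metis doubleton_eq_iff)
  qed
  have bridges: "\<not> reach (?E - {{u, v}}) u v" if uv: "{u, v} \<in> ?E" for u v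
  proof (cases "{u, v} = {a, c}")
    case False
    from lift[OF uv] obtain u' v' where uv': "{u', v'} \<in> E" "p u' = u" "p v' = v" by blast
    let ?F = "E - {{u', v'}}"
    have pim: "p ` {u', v'} = {u, v}" using uv' by simp
    have "p ` {a, c} = {a, c}" "p ` {c, b} = {a, c}" using pa pb pc by auto
    then have "{a, c} \<noteq> {u', v'}" "{c, b} \<noteq> {u', v'}" using pim False by metis+
    then have "{a, c} \<in> ?F" "{c, b} \<in> ?F"
      using ca cb by (auto simp: insert_commute)
    then have Fab: "reach ?F a b" by (meson reach_edge reach_trans)
    have jump: "reach ?F x y" if "p x = p y" for x y
      using fib[OF that] Fab reach_sym[OF Fab] by (metis doubleton_eq_iff reach_refl)
    have "\<forall>x'. p x' = x \<longrightarrow> reach ?F u' x'" if "reach (?E - {{u, v}}) u x" for x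
      using that
    proof (induction rule: reach_induct)
      case base
      then show ?case using jump uv'(2) by metis
    next
      case (step x y)
      then have xy: "{x, y} \<in> ?E" and neq: "{x, y} \<noteq> {u, v}" by blast+
      from lift[OF xy] obtain m n where mn: "{m, n} \<in> E" "p m = x" "p n = y" by blast
      have "p ` {m, n} = {x, y}" using mn by simp
      then have "{m, n} \<noteq> {u', v'}" using pim neq by metis
      then have "reach ?F m n" using mn by (blast intro: reach_edge)
      moreover have "reach ?F u' m" using step.IH mn by blast
      ultimately show ?case using jump mn(3) reach_trans by metis
    qed
    then show ?thesis using is_treeD(7)[OF t uv'(1)] uv' by blast
  next
    case True
    \<comment> \<open>a path from \<open>c\<close> that avoids both folded edges meets neither \<open>a\<close> nor \<open>b\<close>, so it lifts uniquely\<close>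
    let ?F = "E - {{c, a}, {c, b}}"
    have no_a: "\<not> reach ?F c a"
      using is_treeD(7)[OF t ca] reach_mono[of ?F c a "E - {{c, a}}"] by blast
    have no_b: "\<not> reach ?F c b"
      using is_treeD(7)[OF t cb] reach_mono[of ?F c b "E - {{c, b}}"] by blast
    note no = no_a no_b
    have lift_c: "\<exists>x'. p x' = x \<and> reach ?F c x'" if "reach (?E - {{a, c}}) c x" for x
      using that
    proof (induction rule: reach_induct)
      case base
      show ?case using pc by blast
    next
      case (step x y)
      then obtain x' where x': "p x' = x" "reach ?F c x'" by blast
      from step have xy: "{x, y} \<in> ?E" and neq: "{x, y} \<noteq> {a, c}" by blast+
      from lift[OF xy] obtain m n where mn: "{m, n} \<in> E" "p m = x" "p n = y" by blast
      have "x' \<noteq> a" "x' \<noteq> b" using x' no by metis+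
      then have "m = x'" using fib[of m x'] mn x' by (metis doubleton_eq_iff)
      have "p ` {m, n} = {x, y}" using mn by simp
      moreover have "p ` {c, a} = {a, c}" "p ` {c, b} = {a, c}" using pa pb pc by auto
      ultimately have "{m, n} \<noteq> {c, a}" "{m, n} \<noteq> {c, b}" using neq by metis+
      then have "{m, n} \<in> ?F" using mn by blast
      then have "reach ?F c n" using x' \<open>m = x'\<close> by (meson reach_edge reach_trans)
      then show ?case using mn by blast
    qed
    have "x' = a \<or> x' = b" if "p x' = a" for x'
      using that px by metis
    then have nca: "\<not> reach (?E - {{a, c}}) c a" using no lift_c by metis
    then have "\<not> reach (?E - {{a, c}}) a c" using reach_sym by blast
    with True nca show ?thesis by (metis doubleton_eq_iff)
  qed
  have "finite (p ` V)" "p ` V \<noteq> {}" using is_treeD(1,2)[OF t] by auto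
  then have "is_tree (p ` V) ?E"
    unfolding is_tree_def using edges con bridges by blast
  then show ?thesis unfolding p_def .
qed

text \<open>
  Removing an edge leaves two components, each of which is a tree; this is how a birooted tree is
  split at its root edge.
\<close>

definition comp_edges :: "nat set set \<Rightarrow> nat \<Rightarrow> nat set set" where
  "comp_edges E u = {e \<in> E. e \<subseteq> {v. reach E u v}}"

lemma is_tree_component:
  assumes t: "is_tree V E" and sub: "F \<subseteq> E" and u: "u \<in> V"
  shows "is_tree {v. reach F u v} (comp_edges F u)"
proof -
  let ?U = "{v. reach F u v}" and ?F = "comp_edges F u"
  have UV: "?U \<subseteq> V"
  proof
    fix v assume "v \<in> ?U"
    then have "reach F u v" by simp
    then show "v \<in> V"
    proof (induction rule: reach_induct)
      case (step x y)
      then show ?case using is_treeD(4)[OF t] sub by blast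
    qed (rule u)
  qed
  have con: "reach ?F u v" if "reach F u v" for v
    using that
  proof (induction rule: reach_induct)
    case (step x y)
    then have "reach F u y" by (meson reach_edge reach_trans)
    with step have "{x, y} \<in> ?F" unfolding comp_edges_def by simp
    then show ?case using step by (meson reach_edge reach_trans)
  qed simp
  have "\<forall>x y. {x, y} \<in> ?F \<longrightarrow> \<not> reach (?F - {{x, y}}) x y"
  proof (intro allI impI)
    fix x y assume "{x, y} \<in> ?F"
    then have "{x, y} \<in> E" using sub unfolding comp_edges_def by blast
    moreover have "?F - {{x, y}} \<subseteq> E - {{x, y}}" using sub unfolding comp_edges_def by blast
    ultimately show "\<not> reach (?F - {{x, y}}) x y"
      using is_treeD(7)[OF t, of x y] reach_mono by blast
  qed
  moreover have "\<forall>e \<in> ?F. e \<subseteq> ?U \<and> card e = 2"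
    using sub t unfolding comp_edges_def is_tree_def by blast
  moreover have "finite ?U" using UV is_treeD(1)[OF t] by (rule finite_subset)
  moreover have "?U \<noteq> {}" using reach_refl by blast
  moreover have "\<forall>v \<in> ?U. \<forall>w \<in> ?U. reach ?F v w"
    using reach_trans[OF reach_sym[OF con] con] by simp
  ultimately show ?thesis
    unfolding is_tree_def by - (intro conjI; assumption)
qed

lemma split_at_edge:
  assumes t: "is_tree V E" and lr: "{l, r} \<in> E"
  defines "F \<equiv> E - {{l, r}}"
  shows "V = {v. reach F l v} \<union> {v. reach F r v}"
    and "{v. reach F l v} \<inter> {v. reach F r v} = {}"
    and "E = comp_edges F l \<union> comp_edges F r \<union> {{l, r}}"
proof -
  have cover: "reach F l v \<or> reach F r v" if "reach E l v" for v
    using that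
  proof (induction rule: reach_induct)
    case (step x y)
    show ?case
    proof (cases "{x, y} = {l, r}")
      case True
      then show ?thesis by (auto simp: doubleton_eq_iff)
    next
      case False
      then have "reach F x y" using step unfolding F_def by (auto intro: reach_edge)
      then show ?thesis using step.IH reach_trans by blast
    qed
  qed simp
  have V: "l \<in> V" "r \<in> V" using is_treeD(3,4)[OF t lr] by auto
  have stay: "v \<in> V" if "u \<in> V" "reach F u v" for u v
    using that(2)
  proof (induction rule: reach_induct)
    case (step x y)
    then show ?case using is_treeD(4)[OF t] unfolding F_def by blast
  qed (rule that)
  show 1: "V = {v. reach F l v} \<union> {v. reach F r v}"
    using cover is_treeD(6)[OF t V(1)] stay V by blast
  show "{v. reach F l v} \<inter> {v. reach F r v} = {}"
    using is_treeD(7)[OF t lr] reach_trans reach_sym unfolding F_def by blast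
  have "e \<in> comp_edges F l \<union> comp_edges F r" if e: "e \<in> F" for e
  proof -
    obtain x y where xy: "e = {x, y}" "x \<in> V"
      using is_tree_edgeE[OF t] e unfolding F_def by blast
    then have "reach F x y" using e by (simp add: reach_edge)
    then show ?thesis using 1 xy e reach_trans unfolding comp_edges_def by blast
  qed
  then show "E = comp_edges F l \<union> comp_edges F r \<union> {{l, r}}"
    using lr unfolding F_def comp_edges_def by blast
qed

section \<open>Birooted trees\<close>

lemma birooted_iff:
  "t \<in> birooted_trees X \<longleftrightarrow>
    is_tree (verts t) (edges t) \<and> lab t ` verts t \<subseteq> X \<and> {lroot t, rroot t} \<in> edges t"
proof
  assume "is_tree (verts t) (edges t) \<and> lab t ` verts t \<subseteq> X \<and> {lroot t, rroot t} \<in> edges t"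
  then have t: "is_tree (verts t) (edges t)" and X: "lab t ` verts t \<subseteq> X"
    and e: "{lroot t, rroot t} \<in> edges t" by auto
  have "card {lroot t, rroot t} \<le> card (verts t)"
    using is_treeD(1,3,4)[OF t] e by (intro card_mono) auto
  then have "2 \<le> card (verts t)" using is_treeD(5)[OF t e] by simp
  then show "t \<in> birooted_trees X"
    using is_treeD(3,4,5)[OF t e] t X e unfolding birooted_trees_def finite_tree_iff
    by (simp add: adj_def)
qed (auto simp: birooted_trees_def finite_tree_iff adj_def)

text \<open>One-vertex trees stand for the letters in \<open>\<BB>(X)\<close>.\<close>

definition letter_trees :: "'a set \<Rightarrow> 'a btree set" where
  "letter_trees X = {t. verts t = {lroot t} \<and> edges t = {} \<and> rroot t = lroot t \<and> lab t (lroot t) \<in> X}"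

lemma treeD:
  assumes "t \<in> birooted_trees X \<union> letter_trees X"
  shows "is_tree (verts t) (edges t)" "lab t ` verts t \<subseteq> X" "lroot t \<in> verts t" "rroot t \<in> verts t"
proof -
  have "is_tree {v} {}" for v unfolding is_tree_def by simp
  then show "is_tree (verts t) (edges t)" "lab t ` verts t \<subseteq> X" "lroot t \<in> verts t" "rroot t \<in> verts t"
    using assms is_treeD(3,4)[of "verts t" "edges t" "lroot t" "rroot t"]
    by (auto simp: birooted_iff letter_trees_def)
qed

abbreviation il :: "nat \<Rightarrow> nat" where "il v \<equiv> sum_encode (Inl v)"
abbreviation ir :: "nat \<Rightarrow> nat" where "ir v \<equiv> sum_encode (Inr v)"

lemma join_simps [simp]:
  "verts (s \<sqinter>\<^sub>T t) = il ` verts s \<union> ir ` verts t"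
  "edges (s \<sqinter>\<^sub>T t) = (`) il ` edges s \<union> (`) ir ` edges t \<union> {{il (lroot s), ir (rroot t)}}"
  "lab (s \<sqinter>\<^sub>T t) (il v) = lab s v" "lab (s \<sqinter>\<^sub>T t) (ir v) = lab t v"
  "lroot (s \<sqinter>\<^sub>T t) = il (lroot s)" "rroot (s \<sqinter>\<^sub>T t) = ir (rroot t)"
  by (simp_all add: join_def Let_def)

lemma il_ir: "il v = il w \<longleftrightarrow> v = w" "ir v = ir w \<longleftrightarrow> v = w" "il v \<noteq> ir w" "ir w \<noteq> il v"
  by (simp_all add: sum_encode_eq)

lemma join_birooted:
  assumes "s \<in> birooted_trees X \<union> letter_trees X" "t \<in> birooted_trees X \<union> letter_trees X"
  shows "s \<sqinter>\<^sub>T t \<in> birooted_trees X"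
proof -
  have "is_tree (il ` verts s) ((`) il ` edges s)" "is_tree (ir ` verts t) ((`) ir ` edges t)"
    using treeD(1) assms by (auto intro!: is_tree_image inj_onI simp: il_ir)
  then have "is_tree (verts (s \<sqinter>\<^sub>T t)) (edges (s \<sqinter>\<^sub>T t))"
    unfolding join_simps
    by (rule is_tree_disjoint_union)
      (use treeD(3)[OF assms(1)] treeD(4)[OF assms(2)] in \<open>auto simp: il_ir\<close>)
  then show ?thesis
    unfolding birooted_iff using treeD(2)[OF assms(1)] treeD(2)[OF assms(2)] by auto
qed

lemma merge_simps [simp]:
  "verts (merge t a b) = id(b := a) ` verts t"
  "edges (merge t a b) = (`) (id(b := a)) ` edges t"
  "lab (merge t a b) = lab t"
  "lroot (merge t a b) = (id(b := a)) (lroot t)" "rroot (merge t a b) = (id(b := a)) (rroot t)"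
  by (simp_all add: merge_def Let_def)

lemma delete_thorn_simps [simp]:
  "verts (delete_thorn t e a) = verts t - {a}" "edges (delete_thorn t e a) = edges t - {e}"
  "lab (delete_thorn t e a) = lab t"
  "lroot (delete_thorn t e a) = lroot t" "rroot (delete_thorn t e a) = rroot t"
  by (simp_all add: delete_thorn_def)

lemma reduces_birooted:
  assumes r: "reduces t u" and t: "t \<in> birooted_trees X"
  shows "u \<in> birooted_trees X" "card (verts u) < card (verts t)"
    "lab u (lroot u) = lab t (lroot t)" "lab u (rroot u) = lab t (rroot t)"
proof -
  have tr: "is_tree (verts t) (edges t)" and X: "lab t ` verts t \<subseteq> X"
    and e: "{lroot t, rroot t} \<in> edges t" using t by (auto simp: birooted_iff)
  have "u \<in> birooted_trees X \<and> card (verts u) < card (verts t)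
    \<and> lab u (lroot u) = lab t (lroot t) \<and> lab u (rroot u) = lab t (rroot t)"
    using r
  proof cases
    case (thorn_deletion d a)
    then obtain c where d: "d = {a, c}" "{a, c} \<in> edges t" "a \<in> verts t"
        "card {e \<in> edges t. a \<in> e} = 1"
      by (auto simp: thorn_def degree_def)
    have "is_tree (verts u) (edges u)"
      using is_tree_delete_leaf[OF tr d(4,2)] thorn_deletion d by simp
    moreover have "{lroot t, rroot t} \<noteq> d"
      using thorn_deletion d by (auto simp: essential_def doubleton_eq_iff)
    moreover have "card (verts t - {a}) < card (verts t)"
      using d is_treeD(1)[OF tr] by (intro psubset_card_mono) auto
    ultimately show ?thesis
      using thorn_deletion X e by (auto simp: birooted_iff)
  next
    case (edge_folding c a b)
    have ab: "a \<in> verts t" "b \<in> verts t" using edge_folding is_treeD(4)[OF tr] by blast+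
    have "is_tree (verts u) (edges u)"
      using is_tree_merge[OF tr edge_folding(2-4)] edge_folding by simp
    moreover have "{lroot u, rroot u} \<in> edges u"
      using imageI[OF e, of "(`) (id(b := a))"] edge_folding
      by (simp only: merge_simps image_insert image_empty)
    moreover have vu: "verts u = verts t - {b}"
      using ab edge_folding by (auto simp: image_iff)
    moreover have "card (verts t - {b}) < card (verts t)"
      using ab is_treeD(1)[OF tr] by (intro psubset_card_mono) auto
    ultimately show ?thesis
      using edge_folding X by (auto simp: birooted_iff)
  qed
  then show "u \<in> birooted_trees X" "card (verts u) < card (verts t)"
    "lab u (lroot u) = lab t (lroot t)" "lab u (rroot u) = lab t (rroot t)" by auto
qed

lemma reduced_form_exists:
  assumes "t \<in> birooted_trees X"
  shows "\<exists>u. reduces\<^sup>*\<^sup>* t u \<and> reduced u"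
  using assms
proof (induction "card (verts t)" arbitrary: t rule: less_induct)
  case less
  show ?case
  proof (cases "reduced t")
    case False
    then obtain s where "reduces t s" unfolding reduced_def by blast
    with less reduces_birooted[OF this less.prems] show ?thesis
      by (meson converse_rtranclp_into_rtranclp)
  qed blast
qed

lemma tree_isoI:
  assumes "bij_betw \<phi> (verts s) (verts t)" "edges t = (`) \<phi> ` edges s"
    "\<And>v. v \<in> verts s \<Longrightarrow> lab t (\<phi> v) = lab s v"
    "\<phi> (lroot s) = lroot t" "\<phi> (rroot s) = rroot t"
  shows "(s, t) \<in> tree_iso"
  using assms unfolding tree_iso_def by blast

lemma tree_isoE:
  assumes "(s, t) \<in> tree_iso"
  obtains \<phi> where "bij_betw \<phi> (verts s) (verts t)" "edges t = (`) \<phi> ` edges s"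
    "\<And>v. v \<in> verts s \<Longrightarrow> lab t (\<phi> v) = lab s v"
    "\<phi> (lroot s) = lroot t" "\<phi> (rroot s) = rroot t"
  using assms unfolding tree_iso_def by blast

lemma tree_iso_refl: "(t, t) \<in> tree_iso"
  by (rule tree_isoI[where \<phi> = "\<lambda>v. v"]) (auto simp: bij_betw_def)

lemma tree_iso_birooted:
  assumes "(s, t) \<in> tree_iso" "s \<in> birooted_trees X"
  shows "t \<in> birooted_trees X"
proof -
  obtain \<phi> where f: "bij_betw \<phi> (verts s) (verts t)" "edges t = (`) \<phi> ` edges s"
    "\<And>v. v \<in> verts s \<Longrightarrow> lab t (\<phi> v) = lab s v"
    "\<phi> (lroot s) = lroot t" "\<phi> (rroot s) = rroot t"
    using assms(1) by (rule tree_isoE) blast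
  have s: "is_tree (verts s) (edges s)" "lab s ` verts s \<subseteq> X" "{lroot s, rroot s} \<in> edges s"
    using assms(2) by (auto simp: birooted_iff)
  have v: "verts t = \<phi> ` verts s" using f(1) by (simp add: bij_betw_def)
  have "is_tree (verts t) (edges t)"
    unfolding v f(2) using s(1) f(1) by (intro is_tree_image) (simp_all add: bij_betw_def)
  moreover have "{lroot t, rroot t} \<in> edges t"
    using imageI[OF s(3), of "(`) \<phi>"] f by simp
  moreover have "lab t ` verts t \<subseteq> X" using s(2) f(3) unfolding v by auto
  ultimately show ?thesis by (simp add: birooted_iff)
qed

lemma tree_iso_sym:
  assumes st: "(s, t) \<in> tree_iso" and s: "s \<in> birooted_trees X"
  shows "(t, s) \<in> tree_iso"
proof -
  obtain \<phi> where f: "bij_betw \<phi> (verts s) (verts t)" "edges t = (`) \<phi> ` edges s"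
    "\<And>v. v \<in> verts s \<Longrightarrow> lab t (\<phi> v) = lab s v"
    "\<phi> (lroot s) = lroot t" "\<phi> (rroot s) = rroot t"
    using st by (rule tree_isoE) blast
  let ?g = "inv_into (verts s) \<phi>"
  have inj: "inj_on \<phi> (verts s)" using f(1) by (simp add: bij_betw_def)
  have roots: "lroot s \<in> verts s" "rroot s \<in> verts s" using treeD(3,4) s by auto
  have sub: "e \<subseteq> verts s" if "e \<in> edges s" for e
    using that s unfolding birooted_iff is_tree_def by blast
  have "?g ` \<phi> ` e = e" if "e \<in> edges s" for e
    using inv_into_image_cancel[OF inj sub[OF that]] .
  then have "edges s = (`) ?g ` edges t" unfolding f(2) by (simp add: image_image)
  moreover have "lab s (?g v) = lab t v" if "v \<in> verts t" for v
    using f(3)[of "?g v"] bij_betw_inv_into_right[OF f(1) that]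
      bij_betwE[OF bij_betw_inv_into[OF f(1)]] that by simp
  moreover have "?g (lroot t) = lroot s" "?g (rroot t) = rroot s"
    using inv_into_f_f[OF inj] roots f(4,5) by metis+
  ultimately show ?thesis
    using bij_betw_inv_into[OF f(1)] by (intro tree_isoI)
qed

lemma tree_iso_trans:
  assumes "(s, t) \<in> tree_iso" "(t, u) \<in> tree_iso"
  shows "(s, u) \<in> tree_iso"
proof -
  obtain \<phi> where f: "bij_betw \<phi> (verts s) (verts t)" "edges t = (`) \<phi> ` edges s"
    "\<And>v. v \<in> verts s \<Longrightarrow> lab t (\<phi> v) = lab s v"
    "\<phi> (lroot s) = lroot t" "\<phi> (rroot s) = rroot t"
    using assms(1) by (rule tree_isoE) blast
  obtain \<psi> where g: "bij_betw \<psi> (verts t) (verts u)" "edges u = (`) \<psi> ` edges t"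
    "\<And>v. v \<in> verts t \<Longrightarrow> lab u (\<psi> v) = lab t v"
    "\<psi> (lroot t) = lroot u" "\<psi> (rroot t) = rroot u"
    using assms(2) by (rule tree_isoE) blast
  show ?thesis
  proof (rule tree_isoI)
    show "bij_betw (\<psi> \<circ> \<phi>) (verts s) (verts u)" using f(1) g(1) by (rule bij_betw_trans)
    show "edges u = (`) (\<psi> \<circ> \<phi>) ` edges s" unfolding g(2) f(2) by (simp add: image_comp comp_def)
    show "lab u ((\<psi> \<circ> \<phi>) v) = lab s v" if "v \<in> verts s" for v
      using that f(3) g(3) bij_betwE[OF f(1)] by simp
  qed (use f g in auto)
qed

lemma mem_iso_class: "u \<in> iso_class t \<longleftrightarrow> (t, u) \<in> tree_iso"
  by (simp add: iso_class_def)

lemma iso_class_eqI: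
  assumes "(s, t) \<in> tree_iso" "s \<in> birooted_trees X"
  shows "iso_class s = iso_class t"
proof (rule set_eqI)
  fix u show "u \<in> iso_class s \<longleftrightarrow> u \<in> iso_class t"
    unfolding mem_iso_class
    using tree_iso_trans[OF assms(1), of u] tree_iso_trans[OF tree_iso_sym[OF assms], of u] by blast
qed

text \<open>
  Every birooted tree is a join of smaller ones or of letters: cut the root edge. Any neighbour of
  the left root may serve as right root of the left part, since the join forgets it.
\<close>

lemma birooted_split:
  assumes t: "t \<in> birooted_trees X"
  obtains s u where "s \<in> birooted_trees X \<union> letter_trees X" "u \<in> birooted_trees X \<union> letter_trees X"
    "card (verts s) < card (verts t)" "card (verts u) < card (verts t)" "(s \<sqinter>\<^sub>T u, t) \<in> tree_iso"
proof -
  have tr: "is_tree (verts t) (edges t)" and X: "lab t ` verts t \<subseteq> X"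
    and e: "{lroot t, rroot t} \<in> edges t" using t by (auto simp: birooted_iff)
  define F where "F = edges t - {{lroot t, rroot t}}"
  define U where "U w = {v. reach F w v}" for w
  note split = split_at_edge[OF tr e, folded F_def, folded U_def]
  have roots: "lroot t \<in> verts t" "rroot t \<in> verts t" using is_treeD(3,4)[OF tr e] by auto
  have comp: "is_tree (U w) (comp_edges F w)" if "w \<in> verts t" for w
    unfolding U_def by (rule is_tree_component[OF tr _ that]) (auto simp: F_def)
  have self: "w \<in> U w" for w by (simp add: U_def)
  \<comment> \<open>the second root of a part: a neighbour of \<open>w\<close>, or \<open>w\<close> itself if there is none\<close>
  have "\<exists>w'. (U w = {w} \<and> w' = w) \<or> {w, w'} \<in> comp_edges F w" if w: "w \<in> verts t" for w
  proof (cases "U w = {w}")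
    case False
    then obtain v where v: "v \<in> U w" "v \<noteq> w" using self by blast
    then have "(\<lambda>x y. {x, y} \<in> comp_edges F w)\<^sup>*\<^sup>* w v"
      using is_treeD(6)[OF comp[OF w]] self unfolding reach_def by blast
    then show ?thesis using v(2) by (cases rule: converse_rtranclpE) auto
  qed blast
  then obtain nb where nb: "\<And>w. w \<in> verts t \<Longrightarrow>
      (U w = {w} \<and> nb w = w) \<or> {w, nb w} \<in> comp_edges F w"
    by metis
  have no_edges: "comp_edges F w = {}" if w: "w \<in> verts t" "U w = {w}" for w
  proof (rule ccontr)
    assume "comp_edges F w \<noteq> {}"
    then obtain d where "d \<in> comp_edges F w" by blast
    then obtain x y where "x \<noteq> y" "x \<in> U w" "y \<in> U w"
      using is_tree_edgeE[OF comp[OF w(1)]] by metis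
    with w(2) show False by simp
  qed
  have part: "\<lparr>verts = U w, edges = comp_edges F w, lab = lab t, lroot = p, rroot = q\<rparr>
      \<in> birooted_trees X \<union> letter_trees X"
    if w: "w \<in> verts t" "U w \<subseteq> verts t" and pq: "p = w \<and> q = nb w \<or> p = nb w \<and> q = w" for w p q
  proof (cases "U w = {w} \<and> nb w = w")
    case True
    then show ?thesis
      using no_edges[OF w(1)] X w(1) pq by (auto simp: letter_trees_def)
  next
    case False
    then have "{w, nb w} \<in> comp_edges F w" using nb[OF w(1)] by blast
    then show ?thesis
      using comp[OF w(1)] X w(2) pq by (auto simp: birooted_iff insert_commute)
  qed
  define L where "L = \<lparr>verts = U (lroot t), edges = comp_edges F (lroot t), lab = lab t,
    lroot = lroot t, rroot = nb (lroot t)\<rparr>"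
  define R where "R = \<lparr>verts = U (rroot t), edges = comp_edges F (rroot t), lab = lab t,
    lroot = nb (rroot t), rroot = rroot t\<rparr>"
  have "U (lroot t) \<subset> verts t" "U (rroot t) \<subset> verts t"
    using split(1,2) self[of "lroot t"] self[of "rroot t"] by blast+
  then have cards: "card (verts L) < card (verts t)" "card (verts R) < card (verts t)"
    using is_treeD(1)[OF tr] unfolding L_def R_def by (auto intro: psubset_card_mono)
  have sub: "U (lroot t) \<subseteq> verts t" "U (rroot t) \<subseteq> verts t" using split(1) by blast+
  have L: "L \<in> birooted_trees X \<union> letter_trees X"
    unfolding L_def by (rule part[OF roots(1) sub(1)]) simp
  have R: "R \<in> birooted_trees X \<union> letter_trees X"
    unfolding R_def by (rule part[OF roots(2) sub(2)]) simp
  define \<phi> where "\<phi> n = (case sum_decode n of Inl v \<Rightarrow> v | Inr v \<Rightarrow> v)" for n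
  have \<phi>: "\<phi> (il v) = v" "\<phi> (ir v) = v" for v by (simp_all add: \<phi>_def)
  have "(L \<sqinter>\<^sub>T R, t) \<in> tree_iso"
  proof (rule tree_isoI)
    have "inj_on \<phi> (verts (L \<sqinter>\<^sub>T R))"
      using split(2) by (auto simp: inj_on_def \<phi> L_def R_def)
    moreover have "\<phi> ` verts (L \<sqinter>\<^sub>T R) = verts t"
      using split(1) by (simp add: image_Un image_image \<phi> L_def R_def)
    ultimately show "bij_betw \<phi> (verts (L \<sqinter>\<^sub>T R)) (verts t)" by (simp add: bij_betw_def)
    have "(`) \<phi> ` edges (L \<sqinter>\<^sub>T R) =
        comp_edges F (lroot t) \<union> comp_edges F (rroot t) \<union> {{lroot t, rroot t}}"
      by (simp add: image_Un image_image \<phi> L_def R_def)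
    then show "edges t = (`) \<phi> ` edges (L \<sqinter>\<^sub>T R)" using split(3) by simp
  qed (auto simp: \<phi> L_def R_def)
  with that L R cards show thesis by blast
qed

text \<open>
  The usual induction over terms, with trees in place of terms: every tree is reached from letters by
  the operation, up to isomorphism.
\<close>

lemma birooted_induct [consumes 1, case_names letter join iso]:
  assumes "t \<in> birooted_trees X \<union> letter_trees X"
    and letter: "\<And>t. t \<in> letter_trees X \<Longrightarrow> P t"
    and join: "\<And>s t. s \<in> birooted_trees X \<union> letter_trees X \<Longrightarrow> t \<in> birooted_trees X \<union> letter_trees X \<Longrightarrow>
      P s \<Longrightarrow> P t \<Longrightarrow> P (s \<sqinter>\<^sub>T t)"
    and iso: "\<And>s t. s \<in> birooted_trees X \<Longrightarrow> t \<in> birooted_trees X \<Longrightarrow> (s, t) \<in> tree_iso \<Longrightarrow> P s \<Longrightarrow> P t"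
  shows "P t"
  using assms(1)
proof (induction "card (verts t)" arbitrary: t rule: less_induct)
  case less
  show ?case
  proof (cases "t \<in> letter_trees X")
    case False
    then have t: "t \<in> birooted_trees X" using less.prems by blast
    then show ?thesis
    proof (rule birooted_split)
      fix s u assume "s \<in> birooted_trees X \<union> letter_trees X" "u \<in> birooted_trees X \<union> letter_trees X"
        "card (verts s) < card (verts t)" "card (verts u) < card (verts t)"
        "(s \<sqinter>\<^sub>T u, t) \<in> tree_iso"
      then show "P t"
        using iso[OF join_birooted t] join[of s u] less.hyps[of s] less.hyps[of u] by blast
    qed
  qed (rule letter)
qed

section \<open>Morphisms into folded graphs\<close>

text \<open>
  The two axioms match the two reduction rules: \<open>folded\<close> makes a morphism agree on vertices that can be
  folded, and \<open>twin\<close> provides the image of a thorn.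
\<close>

locale folded_graph =
  fixes nb :: "'k \<Rightarrow> 'k \<Rightarrow> bool" and lb :: "'k \<Rightarrow> 'a"
  assumes nb_sym: "nb p q \<Longrightarrow> nb q p"
    and folded: "nb p q \<Longrightarrow> nb p q' \<Longrightarrow> lb q = lb q' \<Longrightarrow> q = q'"
    and twin: "nb p q \<Longrightarrow> \<exists>p'. nb p p' \<and> lb p' = lb p"
begin

definition morphism :: "'a btree \<Rightarrow> (nat \<Rightarrow> 'k) \<Rightarrow> bool" where
  "morphism t \<phi> \<longleftrightarrow> (\<forall>v \<in> verts t. lb (\<phi> v) = lab t v \<and> (\<exists>q. nb (\<phi> v) q))
    \<and> (\<forall>u v. {u, v} \<in> edges t \<longrightarrow> nb (\<phi> u) (\<phi> v))"

text \<open>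
  Closing the image under neighbours of the same label makes it blind to thorns.
\<close>

definition closure :: "'k set \<Rightarrow> 'k set" where
  "closure C = C \<union> {q. \<exists>p \<in> C. nb p q \<and> lb q = lb p}"

text \<open>
  Of each morphism, \<open>sem\<close> keeps the images of the roots, which control how the tree can be joined to
  another one, and the closed image.
\<close>

definition sem :: "'a btree \<Rightarrow> ('k \<times> 'k \<times> 'k set) set" where
  "sem t = {(\<phi> (lroot t), \<phi> (rroot t), closure (\<phi> ` verts t)) | \<phi>. morphism t \<phi>}"

definition smult :: "('k \<times> 'k \<times> 'k set) set \<Rightarrow> ('k \<times> 'k \<times> 'k set) set \<Rightarrow> ('k \<times> 'k \<times> 'k set) set"
  where "smult M N = {(a, d, C \<union> D) | a b C c d D. (a, b, C) \<in> M \<and> (c, d, D) \<in> N \<and> nb a d}"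

lemma semI: "morphism t \<phi> \<Longrightarrow> \<phi> (lroot t) = a \<Longrightarrow> \<phi> (rroot t) = b \<Longrightarrow> closure (\<phi> ` verts t) = C
    \<Longrightarrow> (a, b, C) \<in> sem t"
  unfolding sem_def by blast

lemma semE:
  assumes "(a, b, C) \<in> sem t"
  obtains \<phi> where "morphism t \<phi>" "\<phi> (lroot t) = a" "\<phi> (rroot t) = b" "closure (\<phi> ` verts t) = C"
  using assms unfolding sem_def by blast

lemma morphismD:
  assumes "morphism t \<phi>"
  shows "v \<in> verts t \<Longrightarrow> lb (\<phi> v) = lab t v" "v \<in> verts t \<Longrightarrow> \<exists>q. nb (\<phi> v) q"
    "{u, v} \<in> edges t \<Longrightarrow> nb (\<phi> u) (\<phi> v)"
  using assms unfolding morphism_def by blast+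

lemma closure_Un: "closure (C \<union> D) = closure C \<union> closure D"
  unfolding closure_def by blast

lemma closure_insert_twin:
  assumes "p \<in> C" "nb p q" "lb q = lb p"
  shows "closure (insert q C) = closure C"
proof -
  have "r = p" if "nb q r" "lb r = lb q" for r
    using folded[OF that(1) nb_sym[OF assms(2)]] that assms by simp
  then show ?thesis using assms unfolding closure_def by auto
qed

lemma morphism_unique:
  assumes t: "is_tree (verts t) (edges t)" and m: "morphism t \<phi>" "morphism t \<psi>"
    and u: "u \<in> verts t" "\<phi> u = \<psi> u" and v: "v \<in> verts t"
  shows "\<phi> v = \<psi> v"
proof -
  have "reach (edges t) u v" using is_treeD(6)[OF t] u v by blast
  then show ?thesis
  proof (induction rule: reach_induct)
    case base
    show ?case by (rule u)
  next
    case (step x y)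
    have y: "y \<in> verts t" using is_treeD(4)[OF t step(2)] .
    show ?case
      using folded[OF morphismD(3)[OF m(1) step(2)]] morphismD(3)[OF m(2) step(2)]
        morphismD(1)[OF m(1) y] morphismD(1)[OF m(2) y] step.IH by simp
  qed
qed

lemma doubleton_image:
  assumes "inj f" "{u, v} = f ` e"
  obtains a b where "u = f a" "v = f b" "e = {a, b}"
proof -
  obtain a b where ab: "u = f a" "v = f b" using assms(2) by (metis imageE insertI1 insertI2)
  then have "f ` e = f ` {a, b}" using assms(2) by simp
  then have "e = {a, b}" using assms(1) by (simp only: inj_image_eq_iff)
  with ab show thesis by (rule that)
qed

lemma inj_il_ir: "inj il" "inj ir"
  by (simp_all add: inj_on_def il_ir)

lemma morphism_join:
  "morphism (s \<sqinter>\<^sub>T t) \<chi> \<longleftrightarrow> morphism s (\<chi> \<circ> il) \<and> morphism t (\<chi> \<circ> ir) \<and>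
    nb (\<chi> (il (lroot s))) (\<chi> (ir (rroot t)))"
    (is "?L \<longleftrightarrow> ?R")
proof
  assume L: ?L
  have "nb (\<chi> (il u)) (\<chi> (il v))" if "{u, v} \<in> edges s" for u v
    using imageI[OF that, of "(`) il"] by (intro morphismD(3)[OF L]) simp
  moreover have "nb (\<chi> (ir u)) (\<chi> (ir v))" if "{u, v} \<in> edges t" for u v
    using imageI[OF that, of "(`) ir"] by (intro morphismD(3)[OF L]) simp
  moreover have "nb (\<chi> (il (lroot s))) (\<chi> (ir (rroot t)))"
    by (intro morphismD(3)[OF L]) simp
  ultimately show ?R
    using morphismD(1,2)[OF L] unfolding morphism_def by auto
next
  assume R: ?R
  then have m: "morphism s (\<chi> \<circ> il)" "morphism t (\<chi> \<circ> ir)"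
    and n: "nb (\<chi> (il (lroot s))) (\<chi> (ir (rroot t)))" by auto
  have "nb (\<chi> u) (\<chi> v)" if uv: "{u, v} \<in> edges (s \<sqinter>\<^sub>T t)" for u v
  proof -
    consider e where "e \<in> edges s" "{u, v} = il ` e" | e where "e \<in> edges t" "{u, v} = ir ` e"
      | "{u, v} = {il (lroot s), ir (rroot t)}"
      using uv by auto
    then show ?thesis
    proof cases
      case 1
      then show ?thesis using morphismD(3)[OF m(1)] inj_il_ir(1) by (elim doubleton_image) auto
    next
      case 2
      then show ?thesis using morphismD(3)[OF m(2)] inj_il_ir(2) by (elim doubleton_image) auto
    next
      case 3
      then show ?thesis using n nb_sym[OF n] by (auto simp: doubleton_eq_iff)
    qed
  qed
  then show ?L
    using morphismD(1,2)[OF m(1)] morphismD(1,2)[OF m(2)] unfolding morphism_def by auto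
qed

text \<open>The operation on trees becomes gluing of morphisms along the new root edge.\<close>

lemma sem_join: "sem (s \<sqinter>\<^sub>T t) = smult (sem s) (sem t)"
proof (intro equalityI subrelI subsetI)
  fix x assume x: "x \<in> sem (s \<sqinter>\<^sub>T t)"
  obtain a d E where x_eq: "x = (a, d, E)" by (cases x)
  from x[unfolded x_eq] obtain \<chi> where \<chi>: "morphism (s \<sqinter>\<^sub>T t) \<chi>" "\<chi> (il (lroot s)) = a"
    "\<chi> (ir (rroot t)) = d" "closure (\<chi> ` (il ` verts s \<union> ir ` verts t)) = E"
    by (auto elim: semE)
  have m: "morphism s (\<chi> \<circ> il)" "morphism t (\<chi> \<circ> ir)" "nb a d"
    using \<chi> unfolding morphism_join by auto
  have "(a, (\<chi> \<circ> il) (rroot s), closure ((\<chi> \<circ> il) ` verts s)) \<in> sem s"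
    using m(1) \<chi>(2) by (intro semI[of s "\<chi> \<circ> il"]) auto
  moreover have "((\<chi> \<circ> ir) (lroot t), d, closure ((\<chi> \<circ> ir) ` verts t)) \<in> sem t"
    using m(2) \<chi>(3) by (intro semI[of t "\<chi> \<circ> ir"]) auto
  moreover have "E = closure ((\<chi> \<circ> il) ` verts s) \<union> closure ((\<chi> \<circ> ir) ` verts t)"
    using \<chi>(4) by (simp add: image_Un closure_Un image_comp)
  ultimately show "x \<in> smult (sem s) (sem t)"
    unfolding smult_def x_eq using m(3) by blast
next
  fix x assume "x \<in> smult (sem s) (sem t)"
  then obtain a b C c d D where x: "x = (a, d, C \<union> D)" "(a, b, C) \<in> sem s" "(c, d, D) \<in> sem t"
    "nb a d" unfolding smult_def by blast
  obtain \<phi> where \<phi>: "morphism s \<phi>" "\<phi> (lroot s) = a" "closure (\<phi> ` verts s) = C"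
    using x(2) by (auto elim: semE)
  obtain \<psi> where \<psi>: "morphism t \<psi>" "\<psi> (rroot t) = d" "closure (\<psi> ` verts t) = D"
    using x(3) by (auto elim: semE)
  define \<chi> where "\<chi> n = (case sum_decode n of Inl v \<Rightarrow> \<phi> v | Inr v \<Rightarrow> \<psi> v)" for n
  have c: "\<chi> \<circ> il = \<phi>" "\<chi> \<circ> ir = \<psi>" by (simp_all add: \<chi>_def fun_eq_iff)
  then have e: "\<chi> (il v) = \<phi> v" "\<chi> (ir v) = \<psi> v" for v by (simp_all add: fun_eq_iff)
  have "morphism (s \<sqinter>\<^sub>T t) \<chi>" unfolding morphism_join c e using \<phi> \<psi> x(4) by simp
  moreover have "closure (\<chi> ` verts (s \<sqinter>\<^sub>T t)) = C \<union> D"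
    using \<phi>(3) \<psi>(3) by (simp add: image_Un closure_Un image_image e)
  ultimately show "x \<in> sem (s \<sqinter>\<^sub>T t)"
    unfolding x(1) using \<phi> \<psi> by (intro semI[of _ \<chi>]) (simp_all add: e)
qed

lemma sem_iso_subset:
  assumes "(s, t) \<in> tree_iso"
  shows "sem t \<subseteq> sem s"
proof
  fix x assume x: "x \<in> sem t"
  obtain a d E where x_eq: "x = (a, d, E)" by (cases x)
  from x[unfolded x_eq] obtain \<chi> where \<chi>: "morphism t \<chi>" "\<chi> (lroot t) = a"
    "\<chi> (rroot t) = d" "closure (\<chi> ` verts t) = E"
    by (rule semE)
  obtain \<phi> where f: "bij_betw \<phi> (verts s) (verts t)" "edges t = (`) \<phi> ` edges s"
    "\<And>v. v \<in> verts s \<Longrightarrow> lab t (\<phi> v) = lab s v"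
    "\<phi> (lroot s) = lroot t" "\<phi> (rroot s) = rroot t"
    using assms by (rule tree_isoE) blast
  have "nb (\<chi> (\<phi> u)) (\<chi> (\<phi> v))" if "{u, v} \<in> edges s" for u v
    using imageI[OF that, of "(`) \<phi>"] f(2) by (intro morphismD(3)[OF \<chi>(1)]) simp
  then have "morphism s (\<chi> \<circ> \<phi>)"
    using morphismD(1,2)[OF \<chi>(1)] f(3) bij_betwE[OF f(1)] unfolding morphism_def by simp
  moreover have "(\<chi> \<circ> \<phi>) ` verts s = \<chi> ` verts t"
    unfolding bij_betw_imp_surj_on[OF f(1), symmetric] by (simp add: image_comp)
  ultimately show "x \<in> sem s"
    unfolding x_eq using \<chi> f(4,5) by (intro semI[of s "\<chi> \<circ> \<phi>"]) simp_all
qed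

lemma sem_iso:
  assumes "(s, t) \<in> tree_iso" "s \<in> birooted_trees X"
  shows "sem s = sem t"
  using sem_iso_subset[OF assms(1)] sem_iso_subset[OF tree_iso_sym[OF assms]] by blast

text \<open>
  Composition with the identification of \<open>a\<close> and \<open>b\<close> turns the morphisms of the merged tree into those
  of the original one. It reaches all of them because the target is folded.
\<close>

lemma sem_merge:
  assumes "{c, a} \<in> edges t" "{c, b} \<in> edges t" "a \<in> verts t" "b \<in> verts t" "lab t a = lab t b"
    and t: "is_tree (verts t) (edges t)"
  shows "sem (merge t a b) = sem t"
proof (intro equalityI subsetI)
  let ?p = "id(b := a)"
  have vp: "?p v \<in> verts t" "lab t (?p v) = lab t v" if "v \<in> verts t" for v
    using that assms by auto
  {
    fix x assume x: "x \<in> sem (merge t a b)"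
    obtain l r C where x_eq: "x = (l, r, C)" by (cases x)
    from x[unfolded x_eq] obtain \<phi> where \<phi>: "morphism (merge t a b) \<phi>" "\<phi> (?p (lroot t)) = l"
      "\<phi> (?p (rroot t)) = r" "closure (\<phi> ` ?p ` verts t) = C"
      by (rule semE) (simp only: merge_simps)
    have "nb (\<phi> (?p u)) (\<phi> (?p v))" if "{u, v} \<in> edges t" for u v
      using imageI[OF that, of "(`) ?p"]
      by (intro morphismD(3)[OF \<phi>(1)]) (simp only: merge_simps image_insert image_empty)
    moreover have "lb (\<phi> (?p v)) = lab t v \<and> (\<exists>q. nb (\<phi> (?p v)) q)" if "v \<in> verts t" for v
      using morphismD(1,2)[OF \<phi>(1), of "?p v"] vp[OF that] imageI[OF that, of ?p]
      by (simp only: merge_simps)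
    ultimately have "morphism t (\<phi> \<circ> ?p)" unfolding morphism_def o_def by blast
    then show "x \<in> sem t"
      unfolding x_eq using \<phi>(2-4)
      by (intro semI[of t "\<phi> \<circ> ?p"]) (simp_all only: o_def image_image)
  next
    fix x assume x: "x \<in> sem t"
    obtain l r C where x_eq: "x = (l, r, C)" by (cases x)
    from x[unfolded x_eq] obtain \<phi> where \<phi>: "morphism t \<phi>" "\<phi> (lroot t) = l"
      "\<phi> (rroot t) = r" "closure (\<phi> ` verts t) = C"
      by (rule semE)
    have "\<phi> a = \<phi> b"
      using folded[OF morphismD(3)[OF \<phi>(1) assms(1)] morphismD(3)[OF \<phi>(1) assms(2)]]
        morphismD(1)[OF \<phi>(1)] assms by simp
    then have \<phi>p: "\<phi> (?p v) = \<phi> v" for v by simp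
    have "nb (\<phi> u) (\<phi> v)" if uv: "{u, v} \<in> (`) ?p ` edges t" for u v
    proof -
      obtain e where e: "e \<in> edges t" "{u, v} = ?p ` e" using uv by blast
      obtain m n where "e = {m, n}" using is_tree_edgeE[OF t e(1)] by metis
      then have "{u, v} = {?p m, ?p n}" "nb (\<phi> m) (\<phi> n)"
        using e morphismD(3)[OF \<phi>(1)] by (simp_all only: image_insert image_empty)
      then show ?thesis using nb_sym[of "\<phi> m" "\<phi> n"] \<phi>p by (metis doubleton_eq_iff)
    qed
    moreover have "lb (\<phi> v) = lab t v \<and> (\<exists>q. nb (\<phi> v) q)" if "v \<in> ?p ` verts t" for v
      using morphismD(1,2)[OF \<phi>(1)] vp that by blast
    ultimately have "morphism (merge t a b) \<phi>" unfolding morphism_def merge_simps by blast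
    then show "x \<in> sem (merge t a b)"
      unfolding x_eq by (rule semI) (simp_all only: merge_simps \<phi>p \<phi> image_image)
  }
qed

text \<open>
  The vertex that is put back must go to the neighbour of \<open>\<phi> c\<close> with the label of \<open>c\<close>, and this
  vertex belongs to the closed image anyway.
\<close>

lemma sem_delete_thorn:
  assumes t: "is_tree (verts t) (edges t)" and th: "thorn t e a" "\<not> essential t a"
  shows "sem (delete_thorn t e a) = sem t"
proof (intro equalityI subsetI)
  obtain c where c: "e = {a, c}" "{a, c} \<in> edges t" "lab t a = lab t c"
    and deg: "card {e \<in> edges t. a \<in> e} = 1"
    using th(1) unfolding thorn_def degree_def by auto
  have ne: "a \<noteq> c" "a \<in> verts t" "c \<in> verts t" using is_treeD(3-5)[OF t c(2)] by auto
  have roots: "lroot t \<noteq> a" "rroot t \<noteq> a" using th(2) by (auto simp: essential_def)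
  have only: "d = {a, c}" if "d \<in> edges t" "a \<in> d" for d
    using leaf_edge_unique[OF deg that c(2)] by simp
  have split: "verts t = insert a (verts t - {a})" using ne by blast
  {
    fix x assume x: "x \<in> sem (delete_thorn t e a)"
    obtain l r C where x_eq: "x = (l, r, C)" by (cases x)
    from x[unfolded x_eq] obtain \<phi> where \<phi>: "morphism (delete_thorn t e a) \<phi>" "\<phi> (lroot t) = l"
      "\<phi> (rroot t) = r" "closure (\<phi> ` (verts t - {a})) = C"
      by (rule semE) (simp only: delete_thorn_simps)
    have cv: "lb (\<phi> c) = lab t c" "\<exists>q. nb (\<phi> c) q" using morphismD(1,2)[OF \<phi>(1), of c] ne by auto
    then obtain p where p: "nb (\<phi> c) p" "lb p = lb (\<phi> c)" using twin by blast
    let ?\<psi> = "\<phi>(a := p)"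
    have "nb (?\<psi> u) (?\<psi> v)" if uv: "{u, v} \<in> edges t" for u v
    proof (cases "a \<in> {u, v}")
      case True
      then have "{u, v} = {a, c}" using only uv by blast
      then show ?thesis using p(1) nb_sym[OF p(1)] ne by (auto simp: doubleton_eq_iff)
    next
      case False
      then have "{u, v} \<in> edges (delete_thorn t e a)" using uv c by auto
      then show ?thesis using morphismD(3)[OF \<phi>(1)] False by auto
    qed
    moreover have "lb (?\<psi> v) = lab t v \<and> (\<exists>q. nb (?\<psi> v) q)" if "v \<in> verts t" for v
      using morphismD(1,2)[OF \<phi>(1), of v] that p c(3) cv(1) nb_sym[OF p(1)] by auto
    ultimately have "morphism t ?\<psi>" unfolding morphism_def by blast
    moreover have im: "?\<psi> ` (verts t - {a}) = \<phi> ` (verts t - {a})" by auto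
    have "?\<psi> ` verts t = insert p (\<phi> ` (verts t - {a}))"
      by (subst split) (simp only: image_insert im fun_upd_same)
    then have "closure (?\<psi> ` verts t) = C"
      using closure_insert_twin[OF _ p] ne \<phi>(4) by simp
    ultimately show "x \<in> sem t"
      unfolding x_eq using \<phi>(2,3) roots by (intro semI[of t ?\<psi>]) simp_all
  next
    fix x assume x: "x \<in> sem t"
    obtain l r C where x_eq: "x = (l, r, C)" by (cases x)
    from x[unfolded x_eq] obtain \<phi> where \<phi>: "morphism t \<phi>" "\<phi> (lroot t) = l"
      "\<phi> (rroot t) = r" "closure (\<phi> ` verts t) = C"
      by (rule semE)
    have "morphism (delete_thorn t e a) \<phi>"
      using \<phi>(1) unfolding morphism_def delete_thorn_simps by blast
    moreover have "closure (insert (\<phi> a) (\<phi> ` (verts t - {a}))) = closure (\<phi> ` (verts t - {a}))"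
      using ne c morphismD(1)[OF \<phi>(1)] nb_sym[OF morphismD(3)[OF \<phi>(1) c(2)]]
      by (intro closure_insert_twin[of "\<phi> c"]) auto
    moreover have "\<phi> ` verts t = insert (\<phi> a) (\<phi> ` (verts t - {a}))"
      by (subst split) (rule image_insert)
    ultimately show "x \<in> sem (delete_thorn t e a)"
      unfolding x_eq using \<phi>(2-4)
      by (intro semI[of _ \<phi>]) (simp_all only: delete_thorn_simps)
  }
qed

lemma sem_reduces:
  assumes r: "reduces t u" and t: "t \<in> birooted_trees X"
  shows "sem u = sem t"
  using r
proof cases
  case (thorn_deletion e a)
  then show ?thesis using sem_delete_thorn t by (simp add: birooted_iff)
next
  case (edge_folding c a b)
  have tr: "is_tree (verts t) (edges t)" using t by (simp add: birooted_iff)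
  show ?thesis
    using sem_merge[OF edge_folding(2,3)] is_treeD(4)[OF tr] edge_folding tr by blast
qed

lemma sem_reduces_rtrancl:
  assumes "reduces\<^sup>*\<^sup>* t u" "t \<in> birooted_trees X"
  shows "u \<in> birooted_trees X \<and> sem u = sem t"
  using assms(1)
proof (induction rule: rtranclp_induct)
  case base
  show ?case using assms by simp
next
  case (step y z)
  then show ?case using reduces_birooted(1) sem_reduces by blast
qed

subsection \<open>The identities\<close>

text \<open>
  A morphism is known once its value at one root is known. In each of the identities several copies
  of the same tree get their roots attached to one vertex, so folding makes the copies coincide.

  What the identities need of \<open>sem t\<close>: its triples agree in their labels, the roots in a
  triple are adjacent, and each of them determines the whole triple.
\<close>

definition coherent :: "('k \<times> 'k \<times> 'k set) set \<Rightarrow> bool" where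
  "coherent M \<longleftrightarrow> (\<forall>a b C a' b' C'. (a, b, C) \<in> M \<longrightarrow> (a', b', C') \<in> M \<longrightarrow>
     lb a = lb a' \<and> lb b = lb b' \<and> nb a b \<and> (a = a' \<longleftrightarrow> b = b') \<and> (a = a' \<longrightarrow> C = C'))"

lemma coherent_sem:
  assumes "t \<in> birooted_trees X"
  shows "coherent (sem t)"
  unfolding coherent_def
proof (intro allI impI)
  have t: "is_tree (verts t) (edges t)" and e: "{lroot t, rroot t} \<in> edges t"
    using assms by (auto simp: birooted_iff)
  have v: "lroot t \<in> verts t" "rroot t \<in> verts t" using is_treeD(3,4)[OF t e] by auto
  fix a b C a' b' C' assume "(a, b, C) \<in> sem t" "(a', b', C') \<in> sem t"
  then obtain \<phi> \<psi> where \<phi>: "morphism t \<phi>" "\<phi> (lroot t) = a" "\<phi> (rroot t) = b"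
      "closure (\<phi> ` verts t) = C"
    and \<psi>: "morphism t \<psi>" "\<psi> (lroot t) = a'" "\<psi> (rroot t) = b'" "closure (\<psi> ` verts t) = C'"
    by (meson semE)
  note u = morphism_unique[OF t \<phi>(1) \<psi>(1)]
  have "\<phi> ` verts t = \<psi> ` verts t" if "a = a'"
    using u[OF v(1)] that \<phi>(2) \<psi>(2) by (intro image_cong) auto
  then show "lb a = lb a' \<and> lb b = lb b' \<and> nb a b \<and> (a = a' \<longleftrightarrow> b = b') \<and> (a = a' \<longrightarrow> C = C')"
    using u[OF v(1) _ v(2)] u[OF v(2) _ v(1)] \<phi> \<psi> morphismD(1)[OF \<phi>(1)] morphismD(1)[OF \<psi>(1)] v
      morphismD(3)[OF \<phi>(1) e] by metis
qed

lemma coherentD: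
  assumes "coherent M" "(a, b, C) \<in> M"
  shows "nb a b" "(a', b', C') \<in> M \<Longrightarrow> nb a d \<Longrightarrow> nb a' d \<Longrightarrow> a' = a \<and> b' = b \<and> C' = C"
    "(a', b', C') \<in> M \<Longrightarrow> nb d b \<Longrightarrow> nb d b' \<Longrightarrow> a' = a \<and> b' = b \<and> C' = C"
proof -
  show "nb a b" using assms unfolding coherent_def by blast
  assume ab': "(a', b', C') \<in> M"
  have c: "lb a' = lb a \<and> lb b' = lb b \<and> (a' = a \<longleftrightarrow> b' = b) \<and> (a' = a \<longrightarrow> C' = C)"
    using assms ab' unfolding coherent_def by blast
  show "nb a d \<Longrightarrow> nb a' d \<Longrightarrow> a' = a \<and> b' = b \<and> C' = C"
    using c folded[OF nb_sym nb_sym, of a' d a] by blast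
  show "nb d b \<Longrightarrow> nb d b' \<Longrightarrow> a' = a \<and> b' = b \<and> C' = C"
    using c folded[of d b' b] by blast
qed

lemma smultI: "(a, b, C) \<in> M \<Longrightarrow> (c, d, D) \<in> N \<Longrightarrow> nb a d \<Longrightarrow> E = C \<union> D \<Longrightarrow> (a, d, E) \<in> smult M N"
  unfolding smult_def by blast

lemma smultE:
  assumes "(a, d, E) \<in> smult M N"
  obtains b C c D where "(a, b, C) \<in> M" "(c, d, D) \<in> N" "nb a d" "E = C \<union> D"
  using assms unfolding smult_def by blast

lemma smult_idem:
  assumes M: "coherent M"
  shows "smult M M = M"
proof (intro equalityI subsetI; clarify)
  fix a d E assume "(a, d, E) \<in> smult M M"
  then obtain b C c D where h: "(a, b, C) \<in> M" "(c, d, D) \<in> M" "nb a d" "E = C \<union> D"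
    by (rule smultE)
  have "c = a \<and> d = b \<and> D = C"
    using coherentD(3)[OF M h(1,2)] coherentD(1)[OF M h(1)] h(3) by blast
  then show "(a, d, E) \<in> M" using h by simp
next
  fix a d E assume h: "(a, d, E) \<in> M"
  then show "(a, d, E) \<in> smult M M" using coherentD(1)[OF M h] by (intro smultI) auto
qed

lemma smult_PS2:
  assumes M: "coherent M"
  shows "smult (smult M N) (smult M K) = smult (smult M N) K"
proof (intro equalityI subsetI; clarify)
  fix a d E assume "(a, d, E) \<in> smult (smult M N) (smult M K)"
  then obtain d1 E1 a2 E2 where "(a, d1, E1) \<in> smult M N" "(a2, d, E2) \<in> smult M K" "nb a d"
    "E = E1 \<union> E2" by (rule smultE)
  moreover from this obtain b1 C1 c1 D1 where "(a, b1, C1) \<in> M" "(c1, d1, D1) \<in> N" "nb a d1"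
    "E1 = C1 \<union> D1" by (elim smultE) blast
  moreover from calculation obtain b2 C2 c2 D2 where "(a2, b2, C2) \<in> M" "(c2, d, D2) \<in> K" "nb a2 d"
    "E2 = C2 \<union> D2" by (elim smultE) blast
  moreover from calculation have "C2 = C1" using coherentD(2)[OF M] by blast
  ultimately show "(a, d, E) \<in> smult (smult M N) K" by (blast intro: smultI)
next
  fix a d E assume "(a, d, E) \<in> smult (smult M N) K"
  then obtain d1 E1 c2 D2 where h: "(a, d1, E1) \<in> smult M N" "(c2, d, D2) \<in> K" "nb a d"
    "E = E1 \<union> D2" by (rule smultE)
  from h(1) obtain b1 C1 c1 D1 where k: "(a, b1, C1) \<in> M" "(c1, d1, D1) \<in> N" "nb a d1"
    "E1 = C1 \<union> D1" by (rule smultE)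
  have "(a, d, C1 \<union> D2) \<in> smult M K" using smultI[OF k(1) h(2,3)] by simp
  moreover have "E = E1 \<union> (C1 \<union> D2)" using h(4) k(4) by blast
  ultimately show "(a, d, E) \<in> smult (smult M N) (smult M K)" by (rule smultI[OF h(1) _ h(3)])
qed

text \<open>
  Both sides of the third identity attach \<open>N\<close>, \<open>K\<close> and \<open>L\<close> to the left root of one copy of \<open>M\<close>. Only
  the edges that force the copies together differ.
\<close>

lemma smult_PS3:
  assumes M: "coherent M"
  shows "smult (smult (smult M N) (smult M K)) (smult M L)
    = smult (smult M N) (smult (smult M K) (smult M L))"
proof (intro equalityI subsetI; clarify)
  fix a d E assume "(a, d, E) \<in> smult (smult (smult M N) (smult M K)) (smult M L)"
  then obtain d2 E12 a3 E3 where h: "(a, d2, E12) \<in> smult (smult M N) (smult M K)"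
    "(a3, d, E3) \<in> smult M L" "nb a d" "E = E12 \<union> E3" by (rule smultE)
  from h(1) obtain d1 E1 a2 E2 where h1: "(a, d1, E1) \<in> smult M N" "(a2, d2, E2) \<in> smult M K"
    "nb a d2" "E12 = E1 \<union> E2" by (rule smultE)
  from h1(1) obtain b1 C1 c1 D1 where m1: "(a, b1, C1) \<in> M" "nb a d1" by (rule smultE) blast
  from h1(2) obtain b2 C2 c2 D2 where m2: "(a2, b2, C2) \<in> M" "nb a2 d2" by (rule smultE) blast
  have "a2 = a" using coherentD(2)[OF M m1(1) m2(1) h1(3) m2(2)] by simp
  then have "(a, d, E2 \<union> E3) \<in> smult (smult M K) (smult M L)"
    using smultI[OF h1(2) h(2)] h(3) by simp
  moreover have "E = E1 \<union> (E2 \<union> E3)" using h(4) h1(4) by blast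
  ultimately show "(a, d, E) \<in> smult (smult M N) (smult (smult M K) (smult M L))"
    by (rule smultI[OF h1(1) _ h(3)])
next
  fix a d E assume "(a, d, E) \<in> smult (smult M N) (smult (smult M K) (smult M L))"
  then obtain d1 E1 a2 E23 where h: "(a, d1, E1) \<in> smult M N"
    "(a2, d, E23) \<in> smult (smult M K) (smult M L)" "nb a d" "E = E1 \<union> E23" by (rule smultE)
  from h(2) obtain d2 E2 a3 E3 where h2: "(a2, d2, E2) \<in> smult M K" "(a3, d, E3) \<in> smult M L"
    "nb a2 d" "E23 = E2 \<union> E3" by (rule smultE)
  from h(1) obtain b1 C1 c1 D1 where m1: "(a, b1, C1) \<in> M" "nb a d1" by (rule smultE) blast
  from h2(1) obtain b2 C2 c2 D2 where m2: "(a2, b2, C2) \<in> M" "nb a2 d2" by (rule smultE) blast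
  have "a2 = a" using coherentD(2)[OF M m1(1) m2(1) h(3) h2(3)] by simp
  then have "(a, d2, E1 \<union> E2) \<in> smult (smult M N) (smult M K)"
    using smultI[OF h(1) h2(1)] m2(2) by simp
  moreover have "E = E1 \<union> E2 \<union> E3" using h(4) h2(4) by blast
  ultimately show "(a, d, E) \<in> smult (smult (smult M N) (smult M K)) (smult M L)"
    by (rule smultI[OF _ h2(2) h(3)])
qed

text \<open>The dual identities follow by exchanging the roots.\<close>

definition flip :: "('k \<times> 'k \<times> 'k set) set \<Rightarrow> ('k \<times> 'k \<times> 'k set) set" where
  "flip M = {(b, a, C) | a b C. (a, b, C) \<in> M}"

lemma flip_iff: "(a, b, C) \<in> flip M \<longleftrightarrow> (b, a, C) \<in> M"
  unfolding flip_def by blast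

lemma flip_flip: "flip (flip M) = M"
  unfolding flip_def by auto

lemma flip_smult: "flip (smult M N) = smult (flip N) (flip M)"
proof (intro equalityI subsetI; clarify)
  fix a d E assume "(a, d, E) \<in> flip (smult M N)"
  then have "(d, a, E) \<in> smult M N" by (simp add: flip_iff)
  then show "(a, d, E) \<in> smult (flip N) (flip M)"
    unfolding smult_def by (auto simp: flip_iff) (metis nb_sym Un_commute)
next
  fix a d E assume "(a, d, E) \<in> smult (flip N) (flip M)"
  then show "(a, d, E) \<in> flip (smult M N)"
    unfolding smult_def by (auto simp: flip_iff) (metis nb_sym Un_commute)
qed

lemma coherent_flip: "coherent M \<Longrightarrow> coherent (flip M)"
  unfolding coherent_def flip_iff using nb_sym by metis

lemma smult_PS2':
  assumes M: "coherent M"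
  shows "smult (smult K M) (smult N M) = smult K (smult N M)"
  using smult_PS2[OF coherent_flip[OF M], of "flip N" "flip K"]
  by (metis flip_smult flip_flip)

lemma smult_PS3':
  assumes M: "coherent M"
  shows "smult (smult L M) (smult (smult K M) (smult N M))
    = smult (smult (smult L M) (smult K M)) (smult N M)"
  using smult_PS3[OF coherent_flip[OF M], of "flip N" "flip K" "flip L"]
  by (metis flip_smult flip_flip)

end

section \<open>The universal folded tree\<close>

text \<open>
  A vertex is the list of labels read from it back to the base point. Since a vertex of a
  folded tree has at most one neighbour per label, a step to the label of the preceding vertex is
  backtracking, and this is the only restriction.
\<close>

fun word :: "'a list \<Rightarrow> bool" where
  "word [] \<longleftrightarrow> False"
| "word [x] \<longleftrightarrow> True"
| "word [x, y] \<longleftrightarrow> True"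
| "word (x # y # z # r) \<longleftrightarrow> x \<noteq> z \<and> word (y # z # r)"

definition wnb :: "'a list \<Rightarrow> 'a list \<Rightarrow> bool" where
  "wnb p q \<longleftrightarrow> word p \<and> word q \<and> (tl p = q \<or> tl q = p)"

lemma word_neighbour:
  assumes "word p"
  shows "\<exists>q. wnb p q \<and> hd q = y"
proof (cases "tl p \<noteq> [] \<and> hd (tl p) = y")
  case True
  then show ?thesis
    using assms by (cases p rule: word.cases) (auto simp: wnb_def intro!: exI[of _ "tl p"])
next
  case False
  then show ?thesis
    using assms by (cases p rule: word.cases) (auto simp: wnb_def intro!: exI[of _ "y # p"])
qed

lemma wnb_folded:
  assumes "wnb p q" "wnb p q'" "hd q = hd q'"
  shows "q = q'"
proof -
  have up: "r = hd r # p" if "tl r = p" "word r" for r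
    using that by (cases r) auto
  have no: False if "tl p = r" "tl r' = p" "word r'" "word r" "hd r = hd r'" for r r'
    using that by (cases r' rule: word.cases) auto
  show ?thesis
    using assms up[of q] up[of q'] no[of q q'] no[of q' q] unfolding wnb_def by metis
qed

interpretation words: folded_graph wnb hd
proof
  show "wnb p q \<Longrightarrow> wnb q p" for p q :: "'a list" unfolding wnb_def by blast
  show "wnb p q \<Longrightarrow> wnb p q' \<Longrightarrow> hd q = hd q' \<Longrightarrow> q = q'" for p q q' :: "'a list"
    by (rule wnb_folded)
  show "wnb p q \<Longrightarrow> \<exists>p'. wnb p p' \<and> hd p' = hd p" for p q :: "'a list"
    using word_neighbour[of p "hd p"] by (auto simp: wnb_def)
qed

lemma tree_iso_root_labels:
  assumes "(s, t) \<in> tree_iso" "s \<in> birooted_trees X"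
  shows "lab t (lroot t) = lab s (lroot s)" "lab t (rroot t) = lab s (rroot s)"
proof -
  obtain \<phi> where "\<And>v. v \<in> verts s \<Longrightarrow> lab t (\<phi> v) = lab s v"
    "\<phi> (lroot s) = lroot t" "\<phi> (rroot s) = rroot t"
    using assms(1) by (rule tree_isoE) blast
  moreover have "lroot s \<in> verts s" "rroot s \<in> verts s" using treeD(3,4) assms(2) by auto
  ultimately show "lab t (lroot t) = lab s (lroot s)" "lab t (rroot t) = lab s (rroot s)"
    by metis+
qed

text \<open>
  In the universal tree every label is available at every vertex, so a morphism can be built along the
  operation, starting from either root. Both roots have to be covered because a join continues from
  the left root of one factor to the right root of the other.
\<close>

lemma words_morphism_exists:
  assumes "t \<in> birooted_trees X \<union> letter_trees X"
  shows "(\<forall>p. word p \<and> hd p = lab t (lroot t) \<longrightarrow> (\<exists>b C. (p, b, C) \<in> words.sem t))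
    \<and> (\<forall>p. word p \<and> hd p = lab t (rroot t) \<longrightarrow> (\<exists>a C. (a, p, C) \<in> words.sem t))"
  using assms
proof (induction rule: birooted_induct)
  case (letter t)
  have "words.morphism t (\<lambda>_. p)" if "word p" "hd p = lab t (lroot t)" for p
  proof -
    have "\<exists>q. wnb p q" using word_neighbour[OF that(1)] by blast
    then show ?thesis using letter that unfolding words.morphism_def letter_trees_def by simp
  qed
  then have "(p, p, words.closure ((\<lambda>_. p) ` verts t)) \<in> words.sem t"
    if "word p" "hd p = lab t (lroot t)" for p
    using that by (intro words.semI[of t "\<lambda>_. p"]) auto
  moreover have "rroot t = lroot t" using letter by (simp add: letter_trees_def)
  ultimately show ?case by auto
next
  case (join s t)
  have "\<exists>b C. (p, b, C) \<in> words.sem (s \<sqinter>\<^sub>T t)" if p: "word p" "hd p = lab s (lroot s)" for p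
  proof -
    obtain q where q: "wnb p q" "hd q = lab t (rroot t)" using word_neighbour[OF p(1)] by blast
    then have "word q" by (simp add: wnb_def)
    with join.IH p q(2) obtain b C c D where "(p, b, C) \<in> words.sem s" "(c, q, D) \<in> words.sem t"
      by metis
    from words.smultI[OF this q(1) refl] show ?thesis unfolding words.sem_join by blast
  qed
  moreover have "\<exists>a C. (a, q, C) \<in> words.sem (s \<sqinter>\<^sub>T t)"
    if q: "word q" "hd q = lab t (rroot t)" for q
  proof -
    obtain p where p: "wnb q p" "hd p = lab s (lroot s)" using word_neighbour[OF q(1)] by blast
    then have "word p" by (simp add: wnb_def)
    with join.IH q p(2) obtain b C c D where "(p, b, C) \<in> words.sem s" "(c, q, D) \<in> words.sem t"
      by metis
    from words.smultI[OF this words.nb_sym[OF p(1)] refl] show ?thesis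
      unfolding words.sem_join by blast
  qed
  ultimately show ?case by simp
next
  case (iso s t)
  then show ?case
    using words.sem_iso[OF iso(3,1)] tree_iso_root_labels[OF iso(3,1)] by simp
qed

section \<open>Reduced trees\<close>

lemma reduced_folded:
  assumes "reduced t" "{c, a} \<in> edges t" "{c, b} \<in> edges t" "lab t a = lab t b"
  shows "a = b"
  using assms edge_folding[of c a t b] unfolding reduced_def by blast

lemma reduced_thorn:
  assumes "reduced t" "thorn t e a"
  shows "essential t a"
  using assms thorn_deletion unfolding reduced_def by blast

text \<open>
  A reduced tree is determined by the closure of its image in the universal tree. It embeds,
  because its simple paths are mapped to words without backtracking, and its image is recovered
  from the closure by removing exactly the non-essential thorns.
\<close>

locale reduced_in_words =
  fixes t :: "'a btree" and \<phi> :: "nat \<Rightarrow> 'a list"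
  assumes tree: "is_tree (verts t) (edges t)" and root_edge: "{lroot t, rroot t} \<in> edges t"
    and red: "reduced t" and morph: "words.morphism t \<phi>"
    and base: "\<phi> (lroot t) = [lab t (lroot t)]"
begin

lemma roots: "lroot t \<in> verts t" "rroot t \<in> verts t"
  using is_treeD(3,4)[OF tree root_edge] by auto

lemma hd_image: "v \<in> verts t \<Longrightarrow> hd (\<phi> v) = lab t v"
  using words.morphismD(1)[OF morph] .

lemma word_image: "v \<in> verts t \<Longrightarrow> word (\<phi> v)"
  using words.morphismD(2)[OF morph] by (auto simp: wnb_def)

lemma edge_image: "{u, v} \<in> edges t \<Longrightarrow> wnb (\<phi> u) (\<phi> v)"
  using words.morphismD(3)[OF morph] .

text \<open>
  Along a simple path from the base point each step must lengthen the word. A step back would return to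
  the word of the vertex before the previous one, so two vertices with equal labels would share a
  neighbour and could be folded.
\<close>

lemma parent:
  assumes v: "v \<in> verts t" "v \<noteq> lroot t"
  obtains w where "{w, v} \<in> edges t" "tl (\<phi> v) = \<phi> w" "w \<in> verts t"
proof -
  from is_treeD(6)[OF tree roots(1) v(1)] have "(\<lambda>x y. {x, y} \<in> edges t)\<^sup>*\<^sup>* (lroot t) v"
    unfolding reach_def .
  from simple_path[OF this] obtain vs where vs: "vs \<noteq> []" "hd vs = lroot t" "last vs = v"
    "distinct vs" "successively (\<lambda>x y. {x, y} \<in> edges t) vs" by blast
  have step: "{vs ! i, vs ! Suc i} \<in> edges t" if "Suc i < length vs" for i
    using vs(5) that by (simp add: successively_conv_nth)
  have up: "tl (\<phi> (vs ! Suc i)) = \<phi> (vs ! i)" if "Suc i < length vs" for i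
    using that
  proof (induction i)
    case 0
    have "\<phi> (vs ! 0) = [lab t (lroot t)]" using base vs(1,2) by (simp add: hd_conv_nth)
    then show ?case using edge_image[OF step[OF 0]] by (auto simp: wnb_def)
  next
    case (Suc i)
    show ?case
    proof (rule ccontr)
      assume "tl (\<phi> (vs ! Suc (Suc i))) \<noteq> \<phi> (vs ! Suc i)"
      then have "\<phi> (vs ! Suc (Suc i)) = \<phi> (vs ! i)"
        using edge_image[OF step[OF Suc.prems]] Suc by (auto simp: wnb_def)
      moreover have e: "{vs ! i, vs ! Suc i} \<in> edges t" "{vs ! Suc i, vs ! Suc (Suc i)} \<in> edges t"
        using step Suc.prems by simp_all
      moreover have "vs ! i \<in> verts t" "vs ! Suc (Suc i) \<in> verts t"
        using is_treeD(3,4)[OF tree] e by blast+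
      ultimately have "lab t (vs ! i) = lab t (vs ! Suc (Suc i))" using hd_image by metis
      then have "vs ! i = vs ! Suc (Suc i)"
        using reduced_folded[OF red _ e(2)] e(1) by (simp add: insert_commute)
      then show False using vs(4) Suc.prems by (simp add: nth_eq_iff_index_eq)
    qed
  qed
  have "length vs \<noteq> 1"
    using vs(1-3) v(2) by (auto simp: length_Suc_conv)
  then have len: "Suc (length vs - 2) < length vs" "Suc (length vs - 2) = length vs - 1"
    using vs(1) length_0_conv[of vs] by linarith+
  then have "vs ! Suc (length vs - 2) = v" using vs(1,3) by (simp add: last_conv_nth)
  then show thesis
    using that[of "vs ! (length vs - 2)"] step[OF len(1)] up[OF len(1)] is_treeD(3)[OF tree] by simp
qed

lemma not_base:
  assumes "v \<in> verts t" "v \<noteq> lroot t"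
  shows "tl (\<phi> v) \<noteq> []"
proof -
  obtain w where "tl (\<phi> v) = \<phi> w" "w \<in> verts t" using parent[OF assms] by metis
  then show ?thesis using word_image[of w] by auto
qed

lemma embedding: "inj_on \<phi> (verts t)"
proof
  fix v w assume "v \<in> verts t" "w \<in> verts t" "\<phi> v = \<phi> w"
  then show "v = w"
  proof (induction "length (\<phi> v)" arbitrary: v w rule: less_induct)
    case less
    show ?case
    proof (cases "v = lroot t \<or> w = lroot t")
      case True
      then have "tl (\<phi> v) = []" "tl (\<phi> w) = []" 
        using less.prems(3) base by (metis list.sel(3))+
      then show ?thesis using not_base less.prems by blast
    next
      case False
      then obtain v' w' where v': "{v', v} \<in> edges t" "tl (\<phi> v) = \<phi> v'" "v' \<in> verts t"
        and w': "{w', w} \<in> edges t" "tl (\<phi> w) = \<phi> w'" "w' \<in> verts t"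
        using less.prems by (meson parent)
      have "\<phi> v \<noteq> []" using word_image[OF less.prems(1)] by auto
      then have "length (\<phi> v') < length (\<phi> v)" using v'(2)[symmetric] by simp
      then have "v' = w'" using less.hyps v' w' less.prems(3) by simp
      then show ?thesis
        using reduced_folded[OF red v'(1)] w'(1) hd_image less.prems by metis
    qed
  qed
qed

lemma edge_iff:
  assumes "v \<in> verts t" "w \<in> verts t"
  shows "{v, w} \<in> edges t \<longleftrightarrow> wnb (\<phi> v) (\<phi> w)"
proof
  have down: "{v, w} \<in> edges t" if "v \<in> verts t" "w \<in> verts t" "tl (\<phi> w) = \<phi> v" for v w
  proof -
    have "w \<noteq> lroot t" using that word_image[OF that(1)] base by auto
    from that(2) this obtain u where u: "{u, w} \<in> edges t" "tl (\<phi> w) = \<phi> u" "u \<in> verts t"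
      by (rule parent)
    then have "u = v" using inj_onD[OF embedding] that by metis
    with u show ?thesis by simp
  qed
  assume "wnb (\<phi> v) (\<phi> w)"
  then show "{v, w} \<in> edges t"
    using down[OF assms] down[OF assms(2,1)] by (auto simp: wnb_def insert_commute)
qed (rule edge_image)

lemma image_tl: "p \<in> \<phi> ` verts t \<Longrightarrow> tl p \<noteq> [] \<Longrightarrow> tl p \<in> \<phi> ` verts t"
proof -
  assume "p \<in> \<phi> ` verts t" "tl p \<noteq> []"
  then obtain v where v: "v \<in> verts t" "p = \<phi> v" by blast
  then have "v \<noteq> lroot t" using \<open>tl p \<noteq> []\<close> base by auto
  from parent[OF v(1) this] v(2) show "tl p \<in> \<phi> ` verts t" by (metis imageI)
qed

text \<open>
  An image vertex other than the roots has a neighbour in the closure whose label differs from its own: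
  otherwise it would be a leaf whose neighbour has its label, that is, a non-essential thorn. A vertex
  that was added by the closure has no such neighbour.
\<close>

lemma image_eq:
  "\<phi> ` verts t = {p \<in> words.closure (\<phi> ` verts t).
    p \<noteq> \<phi> (lroot t) \<longrightarrow> p \<noteq> \<phi> (rroot t) \<longrightarrow>
    (\<exists>q \<in> words.closure (\<phi> ` verts t). wnb p q \<and> hd q \<noteq> hd p)}"
    (is "?I = {p \<in> ?C. ?Q p}")
proof (intro equalityI subsetI)
  fix p assume "p \<in> ?I"
  then obtain a where a: "a \<in> verts t" "p = \<phi> a" by blast
  have IC: "?I \<subseteq> ?C" by (simp add: words.closure_def)
  have "?Q p"
  proof (intro impI, rule ccontr)
    assume ne: "p \<noteq> \<phi> (lroot t)" "p \<noteq> \<phi> (rroot t)"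
      and no: "\<not> (\<exists>q \<in> ?C. wnb p q \<and> hd q \<noteq> hd p)"
    have same: "lab t c = lab t a" if c: "{a, c} \<in> edges t" for c
    proof -
      have cv: "c \<in> verts t" using is_treeD(4)[OF tree c] .
      then have "\<phi> c \<in> ?C" using IC by blast
      then have "hd (\<phi> c) = hd (\<phi> a)" using no edge_image[OF c] unfolding a(2) by blast
      then show ?thesis using hd_image[OF cv] hd_image[OF a(1)] by simp
    qed
    have "a \<noteq> lroot t" using a ne by auto
    then obtain w where w: "{w, a} \<in> edges t" using parent[OF a(1)] by metis
    then have w': "{a, w} \<in> edges t" by (simp add: insert_commute)
    have "d = {a, w}" if d: "d \<in> edges t" "a \<in> d" for d
    proof -
      obtain m n where "d = {m, n}" using is_tree_edgeE[OF tree d(1)] by metis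
      then obtain c where c: "d = {a, c}" using d(2) by (auto simp: insert_commute)
      then show ?thesis
        using reduced_folded[OF red w', of c] same[OF w'] same[of c] d(1) by simp
    qed
    then have "{d \<in> edges t. a \<in> d} = {{a, w}}" using w' by blast
    then have "thorn t {a, w} a"
      using same[OF w'] w' a(1) unfolding thorn_def degree_def by auto
    from reduced_thorn[OF red this] show False using a ne by (auto simp: essential_def)
  qed
  moreover have "p \<in> ?C" using \<open>p \<in> ?I\<close> IC by (rule subsetD[rotated])
  ultimately show "p \<in> {p \<in> ?C. ?Q p}" by simp
next
  fix p assume "p \<in> {p \<in> ?C. ?Q p}"
  then have pC: "p \<in> ?C" and Q: "?Q p" by auto
  show "p \<in> ?I"
  proof (rule ccontr)
    assume pI: "p \<notin> ?I"
    \<comment> \<open>a twin outside the image hangs below its neighbour, and nothing in the closure is below it\<close>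
    have outside: "tl q = r" if "r \<in> ?I" "q \<notin> ?I" "wnb r q" for q r
      using that image_tl[OF that(1)] unfolding wnb_def by (metis word.simps(1))
    from pC pI obtain r where r: "r \<in> ?I" "wnb r p" "hd p = hd r"
      unfolding words.closure_def by blast
    have "p \<noteq> \<phi> (lroot t)" "p \<noteq> \<phi> (rroot t)" using pI roots by auto
    then obtain q where q: "q \<in> ?C" "wnb p q" "hd q \<noteq> hd p" using Q by blast
    have "q \<noteq> r" using q r by auto
    then have qp: "tl q = p" using q(2) outside[OF r(1) pI r(2)] by (auto simp: wnb_def)
    have "p \<noteq> []" using q(2) by (auto simp: wnb_def)
    then have "q \<notin> ?I" using image_tl[of q] qp pI by auto
    with q(1) obtain s where "s \<in> ?I" "wnb s q" unfolding words.closure_def by blast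
    then have "tl q = s" using outside \<open>q \<notin> ?I\<close> by blast
    with qp pI \<open>s \<in> ?I\<close> show False by simp
  qed
qed

end

text \<open>
  Both trees embed in the universal tree with the same base point, and by \<open>image_eq\<close> with the same image.
\<close>

theorem reduced_iso:
  assumes t: "t \<in> birooted_trees X" "reduced t" and u: "u \<in> birooted_trees X" "reduced u"
    and sem: "words.sem t = words.sem u"
  shows "(t, u) \<in> tree_iso"
proof -
  let ?x = "lab t (lroot t)"
  obtain b C where bC: "([?x], b, C) \<in> words.sem t"
    using words_morphism_exists[of t X] t(1) by fastforce
  obtain \<phi> where \<phi>: "words.morphism t \<phi>" "\<phi> (lroot t) = [?x]" "\<phi> (rroot t) = b"
    "words.closure (\<phi> ` verts t) = C" using bC by (rule words.semE)
  obtain \<psi> where \<psi>: "words.morphism u \<psi>" "\<psi> (lroot u) = [?x]" "\<psi> (rroot u) = b"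
    "words.closure (\<psi> ` verts u) = C" using bC[unfolded sem] by (rule words.semE)
  have "lab u (lroot u) = ?x"
    using words.morphismD(1)[OF \<psi>(1), of "lroot u"] \<psi>(2) treeD(3)[of u X] u(1) by simp
  then interpret T: reduced_in_words t \<phi> + U: reduced_in_words u \<psi>
    using t u \<phi> \<psi> by unfold_locales (auto simp: birooted_iff)
  have im: "\<phi> ` verts t = \<psi> ` verts u"
    by (subst T.image_eq, subst U.image_eq) (simp only: \<phi> \<psi>)
  define \<chi> where "\<chi> = inv_into (verts u) \<psi> \<circ> \<phi>"
  have \<psi>\<chi>: "\<psi> (\<chi> v) = \<phi> v" "\<chi> v \<in> verts u" if "v \<in> verts t" for v
  proof -
    have "\<phi> v \<in> \<psi> ` verts u" using that im by blast
    then show "\<psi> (\<chi> v) = \<phi> v" "\<chi> v \<in> verts u"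
      unfolding \<chi>_def o_def by (rule f_inv_into_f, rule inv_into_into)
  qed
  have bij: "bij_betw \<chi> (verts t) (verts u)"
    unfolding \<chi>_def
  proof (rule bij_betw_trans)
    show "bij_betw \<phi> (verts t) (\<phi> ` verts t)" using T.embedding by (simp add: bij_betw_def)
    show "bij_betw (inv_into (verts u) \<psi>) (\<phi> ` verts t) (verts u)"
      unfolding im using U.embedding by (intro bij_betw_inv_into) (simp add: bij_betw_def)
  qed
  have edge: "{v, w} \<in> edges t \<longleftrightarrow> {\<chi> v, \<chi> w} \<in> edges u" if "v \<in> verts t" "w \<in> verts t" for v w
    using T.edge_iff[OF that] U.edge_iff[of "\<chi> v" "\<chi> w"] \<psi>\<chi> that by simp
  show ?thesis
  proof (rule tree_isoI[OF bij])
    show "edges u = (`) \<chi> ` edges t"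
    proof (intro equalityI subsetI)
      fix e assume e: "e \<in> edges u"
      then obtain m n where mn: "e = {m, n}" "m \<in> verts u" "n \<in> verts u"
        using is_tree_edgeE[OF U.tree] by metis
      then obtain v w where vw: "v \<in> verts t" "w \<in> verts t" "m = \<chi> v" "n = \<chi> w"
        using bij_betw_imp_surj_on[OF bij] by blast
      then have "{v, w} \<in> edges t" using edge e mn by simp
      from imageI[OF this, of "(`) \<chi>"] show "e \<in> (`) \<chi> ` edges t" using mn vw by simp
    next
      fix e assume "e \<in> (`) \<chi> ` edges t"
      then obtain d where d: "d \<in> edges t" "e = \<chi> ` d" by blast
      then obtain m n where "d = {m, n}" "m \<in> verts t" "n \<in> verts t"
        using is_tree_edgeE[OF T.tree] by metis
      then show "e \<in> edges u" using edge d by simp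
    qed
    show "lab u (\<chi> v) = lab t v" if "v \<in> verts t" for v
      using T.hd_image[OF that] U.hd_image[of "\<chi> v"] \<psi>\<chi>[OF that] by simp
    show "\<chi> (lroot t) = lroot u" "\<chi> (rroot t) = rroot u"
      using \<psi>\<chi>[OF T.roots(1)] \<psi>\<chi>[OF T.roots(2)] \<phi> \<psi> U.roots inj_onD[OF U.embedding] by metis+
  qed
qed

section \<open>The algebra of reduced trees\<close>

lemma reduced_form_eq:
  assumes t: "t \<in> birooted_trees X" and u: "reduces\<^sup>*\<^sup>* t u" "reduced u"
  shows "reduced_form t = iso_class u"
  unfolding reduced_form_def
proof (rule the_equality)
  show "\<exists>v. reduces\<^sup>*\<^sup>* t v \<and> reduced v \<and> iso_class u = iso_class v" using u by blast
next
  fix C assume "\<exists>v. reduces\<^sup>*\<^sup>* t v \<and> reduced v \<and> C = iso_class v"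
  then obtain v where v: "reduces\<^sup>*\<^sup>* t v" "reduced v" "C = iso_class v" by blast
  note su = words.sem_reduces_rtrancl[OF u(1) t] and sv = words.sem_reduces_rtrancl[OF v(1) t]
  have "(v, u) \<in> tree_iso" using reduced_iso[of v X u] su sv u(2) v(2) by simp
  from iso_class_eqI[OF this conjunct1[OF sv]] show "C = iso_class u" using v(3) by simp
qed

lemma reduced_formE:
  assumes "t \<in> birooted_trees X"
  obtains u where "u \<in> birooted_trees X" "reduced u" "reduces\<^sup>*\<^sup>* t u" "reduced_form t = iso_class u"
proof -
  obtain u where u: "reduces\<^sup>*\<^sup>* t u" "reduced u" using reduced_form_exists[OF assms] by blast
  have "u \<in> birooted_trees X" using words.sem_reduces_rtrancl[OF u(1) assms] by (rule conjunct1)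
  then show thesis using u(2,1) reduced_form_eq[OF assms u] by (rule that)
qed

text \<open>
  The set \<open>sem\<close> for the universal tree is a complete invariant for having the same reduced form.
\<close>

lemma reduced_form_cong:
  assumes "s \<in> birooted_trees X" "t \<in> birooted_trees X" "words.sem s = words.sem t"
  shows "reduced_form s = reduced_form t"
proof -
  obtain s' where s': "s' \<in> birooted_trees X" "reduced s'" "reduces\<^sup>*\<^sup>* s s'"
    "reduced_form s = iso_class s'" using assms(1) by (rule reduced_formE)
  obtain t' where t': "t' \<in> birooted_trees X" "reduced t'" "reduces\<^sup>*\<^sup>* t t'"
    "reduced_form t = iso_class t'" using assms(2) by (rule reduced_formE)
  have "words.sem s' = words.sem t'"
    using words.sem_reduces_rtrancl[OF s'(3) assms(1)] words.sem_reduces_rtrancl[OF t'(3) assms(2)]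
      assms(3) by simp
  from reduced_iso[OF s'(1,2) t'(1,2) this] have "(s', t') \<in> tree_iso" .
  from iso_class_eqI[OF this s'(1)] show ?thesis using s'(4) t'(4) by simp
qed

lemma reduced_form_reduced:
  assumes "t \<in> birooted_trees X" "reduced t"
  shows "reduced_form t = iso_class t"
  by (rule reduced_form_eq[OF assms(1) rtranclp.rtrancl_refl assms(2)])

lemma reduced_trees_eq: "\<AA> X = reduced_form ` birooted_trees X"
proof (intro equalityI subsetI)
  fix A assume "A \<in> \<AA> X"
  then obtain t where "t \<in> birooted_trees X" "reduced t" "A = iso_class t"
    unfolding reduced_trees_def by blast
  then show "A \<in> reduced_form ` birooted_trees X" using reduced_form_reduced[of t X] by blast
next
  fix A assume "A \<in> reduced_form ` birooted_trees X"
  then obtain t where t: "t \<in> birooted_trees X" "A = reduced_form t" by blast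
  obtain u where "u \<in> birooted_trees X" "reduced u" "reduced_form t = iso_class u"
    using t(1) by (rule reduced_formE) blast
  then show "A \<in> \<AA> X" using t(2) unfolding reduced_trees_def by blast
qed

lemma join_birooted': "s \<in> birooted_trees X \<Longrightarrow> t \<in> birooted_trees X \<Longrightarrow> s \<sqinter>\<^sub>T t \<in> birooted_trees X"
  by (simp add: join_birooted)

lemma wedge_iso_class:
  assumes s: "s \<in> birooted_trees X" and t: "t \<in> birooted_trees X"
  shows "iso_class s \<and>\<^sub>T iso_class t = reduced_form (s \<sqinter>\<^sub>T t)"
proof -
  have eq: "reduced_form (s' \<sqinter>\<^sub>T t') = reduced_form (s \<sqinter>\<^sub>T t)"
    if "s' \<in> iso_class s" "t' \<in> iso_class t" for s' t'
  proof (rule reduced_form_cong)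
    have i: "(s, s') \<in> tree_iso" "(t, t') \<in> tree_iso" using that by (simp_all add: mem_iso_class)
    then show "s' \<sqinter>\<^sub>T t' \<in> birooted_trees X" using s t tree_iso_birooted join_birooted' by metis
    show "s \<sqinter>\<^sub>T t \<in> birooted_trees X" using s t by (rule join_birooted')
    show "words.sem (s' \<sqinter>\<^sub>T t') = words.sem (s \<sqinter>\<^sub>T t)"
      using words.sem_iso[OF i(1) s] words.sem_iso[OF i(2) t] by (simp only: words.sem_join)
  qed
  have mem: "s \<in> iso_class s" "t \<in> iso_class t" by (simp_all add: mem_iso_class tree_iso_refl)
  show ?thesis
    unfolding wedge_def
  proof (intro equalityI subsetI)
    fix x assume "x \<in> (\<Union>s' \<in> iso_class s. \<Union>t' \<in> iso_class t. reduced_form (s' \<sqinter>\<^sub>T t'))"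
    then obtain s' t' where "s' \<in> iso_class s" "t' \<in> iso_class t" "x \<in> reduced_form (s' \<sqinter>\<^sub>T t')"
      by blast
    then show "x \<in> reduced_form (s \<sqinter>\<^sub>T t)" using eq by simp
  next
    fix x assume "x \<in> reduced_form (s \<sqinter>\<^sub>T t)"
    then show "x \<in> (\<Union>s' \<in> iso_class s. \<Union>t' \<in> iso_class t. reduced_form (s' \<sqinter>\<^sub>T t'))"
      by (intro UN_I[OF mem(1)] UN_I[OF mem(2)])
  qed
qed

lemma wedge_reduced_form:
  assumes s: "s \<in> birooted_trees X" and t: "t \<in> birooted_trees X"
  shows "reduced_form s \<and>\<^sub>T reduced_form t = reduced_form (s \<sqinter>\<^sub>T t)"
proof -
  obtain s' where s': "s' \<in> birooted_trees X" "reduces\<^sup>*\<^sup>* s s'" "reduced_form s = iso_class s'"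
    using s by (rule reduced_formE) blast
  obtain t' where t': "t' \<in> birooted_trees X" "reduces\<^sup>*\<^sup>* t t'" "reduced_form t = iso_class t'"
    using t by (rule reduced_formE) blast
  have "words.sem (s' \<sqinter>\<^sub>T t') = words.sem (s \<sqinter>\<^sub>T t)"
    using words.sem_reduces_rtrancl[OF s'(2) s] words.sem_reduces_rtrancl[OF t'(2) t]
    by (simp only: words.sem_join)
  then show ?thesis
    using wedge_iso_class[OF s'(1) t'(1)] s t s' t'
      reduced_form_cong[OF join_birooted'[OF s'(1) t'(1)] join_birooted'[OF s t]] by simp
qed

text \<open>
  Each identity is checked on arbitrary birooted trees before reduction, where it becomes an identity
  of \<open>smult\<close>.
\<close>

theorem reduced_trees_pseudosemilattice: "pseudosemilattice (\<AA> X) (\<and>\<^sub>T)"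
proof -
  let ?B = "birooted_trees X"
  note J = join_birooted' and W = wedge_reduced_form[where X = X]
  note C = words.coherent_sem[where X = X]
  have ps1: "reduced_form x \<and>\<^sub>T reduced_form x = reduced_form x" if "x \<in> ?B" for x
    unfolding W[OF that that]
    by (rule reduced_form_cong[OF J[OF that that] that])
      (simp only: words.sem_join words.smult_idem[OF C[OF that]])
  show ?thesis
  proof
    show "x \<and>\<^sub>T y \<in> \<AA> X" if "x \<in> \<AA> X" "y \<in> \<AA> X" for x y
    proof -
      obtain a b where "a \<in> ?B" "b \<in> ?B" "x = reduced_form a" "y = reduced_form b"
        using \<open>x \<in> \<AA> X\<close> \<open>y \<in> \<AA> X\<close> unfolding reduced_trees_eq by blast
      then show ?thesis
        unfolding reduced_trees_eq using W[of a b] imageI[OF J[of a X b], of reduced_form] by simp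
    qed
    show "x \<and>\<^sub>T x = x" if "x \<in> \<AA> X" for x
      using that ps1 unfolding reduced_trees_eq by blast
  next
    fix x y z assume "x \<in> \<AA> X" "y \<in> \<AA> X" "z \<in> \<AA> X"
    then obtain a b c where B: "a \<in> ?B" "b \<in> ?B" "c \<in> ?B"
      and e: "x = reduced_form a" "y = reduced_form b" "z = reduced_form c"
      unfolding reduced_trees_eq by blast
    show "(x \<and>\<^sub>T y) \<and>\<^sub>T (x \<and>\<^sub>T z) = (x \<and>\<^sub>T y) \<and>\<^sub>T z"
      unfolding e by (simp only: W J B, rule reduced_form_cong[of _ X])
        (simp_all only: J B words.sem_join words.smult_PS2[OF C[OF B(1)]])
    show "(z \<and>\<^sub>T x) \<and>\<^sub>T (y \<and>\<^sub>T x) = z \<and>\<^sub>T (y \<and>\<^sub>T x)"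
      unfolding e by (simp only: W J B, rule reduced_form_cong[of _ X])
        (simp_all only: J B words.sem_join words.smult_PS2'[OF C[OF B(1)]])
  next
    fix x y z w assume "x \<in> \<AA> X" "y \<in> \<AA> X" "z \<in> \<AA> X" "w \<in> \<AA> X"
    then obtain a b c d where B: "a \<in> ?B" "b \<in> ?B" "c \<in> ?B" "d \<in> ?B"
      and e: "x = reduced_form a" "y = reduced_form b" "z = reduced_form c" "w = reduced_form d"
      unfolding reduced_trees_eq by blast
    show "((x \<and>\<^sub>T y) \<and>\<^sub>T (x \<and>\<^sub>T z)) \<and>\<^sub>T (x \<and>\<^sub>T w) = (x \<and>\<^sub>T y) \<and>\<^sub>T ((x \<and>\<^sub>T z) \<and>\<^sub>T (x \<and>\<^sub>T w))"
      unfolding e by (simp only: W J B, rule reduced_form_cong[of _ X])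
        (simp_all only: J B words.sem_join words.smult_PS3[OF C[OF B(1)]])
    show "(w \<and>\<^sub>T x) \<and>\<^sub>T ((z \<and>\<^sub>T x) \<and>\<^sub>T (y \<and>\<^sub>T x)) = ((w \<and>\<^sub>T x) \<and>\<^sub>T (z \<and>\<^sub>T x)) \<and>\<^sub>T (y \<and>\<^sub>T x)"
      unfolding e by (simp only: W J B, rule reduced_form_cong[of _ X])
        (simp_all only: J B words.sem_join words.smult_PS3'[OF C[OF B(1)]])
  qed
qed

section \<open>Letters generate\<close>

definition letter_edge :: "'a \<Rightarrow> 'a btree" where
  "letter_edge x = \<lparr>verts = {0, 1}, edges = {{0, 1}}, lab = (\<lambda>_. x), lroot = 0, rroot = 1\<rparr>"

lemma letter_edge_simps [simp]:
  "verts (letter_edge x) = {0, 1}" "edges (letter_edge x) = {{0, 1}}" "lab (letter_edge x) v = x"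
  "lroot (letter_edge x) = 0" "rroot (letter_edge x) = 1"
  by (simp_all add: letter_edge_def)

lemma letter_eq: "letter x = iso_class (letter_edge x)"
  by (simp add: letter_def letter_edge_def)

lemma letter_edge_birooted: "x \<in> X \<Longrightarrow> letter_edge x \<in> birooted_trees X"
proof -
  assume x: "x \<in> X"
  have single: "is_tree {v} {}" for v unfolding is_tree_def by simp
  have "is_tree ({0} \<union> {1}) ({} \<union> {} \<union> {{0, 1}})"
    by (rule is_tree_disjoint_union[OF single single]) simp_all
  then have "is_tree {0, 1} {{0, 1}}" by (simp add: insert_commute)
  then show ?thesis using x by (simp add: birooted_iff)
qed

lemma letter_edge_reduced: "reduced (letter_edge x)"
  unfolding reduced_def
proof
  assume "\<exists>u. reduces (letter_edge x) u"
  then obtain u where "reduces (letter_edge x) u" by blast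
  then show False
    by cases (auto simp: thorn_def essential_def doubleton_eq_iff)
qed

lemma letter_reduced_form: "x \<in> X \<Longrightarrow> letter x = reduced_form (letter_edge x)"
  unfolding letter_eq
  by (rule reduced_form_reduced[OF letter_edge_birooted letter_edge_reduced, symmetric])

lemma letter_in_reduced_trees: "letter ` X \<subseteq> \<AA> X"
  unfolding reduced_trees_eq
proof
  fix A assume "A \<in> letter ` X"
  then obtain x where x: "x \<in> X" "A = letter x" by blast
  show "A \<in> reduced_form ` birooted_trees X"
    unfolding x(2) letter_reduced_form[OF x(1)]
    by (rule imageI) (rule letter_edge_birooted[OF x(1)])
qed

lemma inj_letter: "inj letter"
proof (rule injI)
  fix x y :: 'a assume "letter x = letter y"
  then have "(letter_edge x, letter_edge y) \<in> tree_iso"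
    unfolding letter_eq using tree_iso_refl mem_iso_class by metis
  from tree_iso_root_labels(1)[OF this letter_edge_birooted[OF UNIV_I]] show "x = y" by simp
qed

context folded_graph
begin

lemma sem_letter_tree:
  assumes "t \<in> letter_trees X"
  shows "sem t = {(p, p, closure {p}) | p. lb p = lab t (lroot t) \<and> (\<exists>q. nb p q)}"
proof -
  have t: "verts t = {lroot t}" "edges t = {}" "rroot t = lroot t"
    using assms by (auto simp: letter_trees_def)
  have m: "morphism t \<phi> \<longleftrightarrow> lb (\<phi> (lroot t)) = lab t (lroot t) \<and> (\<exists>q. nb (\<phi> (lroot t)) q)" for \<phi>
    unfolding morphism_def t(2) by (subst t(1)) auto
  have im: "\<phi> ` verts t = {\<phi> (lroot t)}" for \<phi> :: "nat \<Rightarrow> 'k" by (subst t(1)) simp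
  have ex: "\<exists>\<phi> :: nat \<Rightarrow> 'k. \<phi> (lroot t) = p" for p by (rule exI[of _ "\<lambda>_. p"]) simp
  show ?thesis
    unfolding sem_def m im t(3)
  proof (intro equalityI subsetI)
    fix r assume "r \<in> {(p, p, closure {p}) | p. lb p = lab t (lroot t) \<and> (\<exists>q. nb p q)}"
    then obtain p where p: "r = (p, p, closure {p})" "lb p = lab t (lroot t)" "\<exists>q. nb p q" by blast
    obtain \<phi> :: "nat \<Rightarrow> 'k" where "\<phi> (lroot t) = p" using ex by blast
    then show "r \<in> {(\<phi> (lroot t), \<phi> (lroot t), closure {\<phi> (lroot t)}) | \<phi>.
        lb (\<phi> (lroot t)) = lab t (lroot t) \<and> (\<exists>q. nb (\<phi> (lroot t)) q)}"
      using p by (intro CollectI exI[of _ \<phi>]) simp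
  qed blast
qed

lemma sem_letter_edge:
  "sem (letter_edge x) = {(p, q, closure {p}) | p q. nb p q \<and> lb p = x \<and> lb q = x}"
proof (intro equalityI subsetI)
  have cl: "closure {p, q} = closure {p}" if "nb p q" "lb q = lb p" for p q
    using closure_insert_twin[of p "{p}", OF _ that] by (simp add: insert_commute)
  {
    fix m assume "m \<in> sem (letter_edge x)"
    then obtain \<phi> where \<phi>: "morphism (letter_edge x) \<phi>" "m = (\<phi> 0, \<phi> 1, closure {\<phi> 0, \<phi> 1})"
      unfolding sem_def by auto
    have "nb (\<phi> 0) (\<phi> 1)" "lb (\<phi> 0) = x" "lb (\<phi> 1) = x"
      using morphismD(3)[OF \<phi>(1), of 0 1] morphismD(1)[OF \<phi>(1)] by auto
    then show "m \<in> {(p, q, closure {p}) | p q. nb p q \<and> lb p = x \<and> lb q = x}"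
      using \<phi>(2) cl by auto
  next
    fix m assume "m \<in> {(p, q, closure {p}) | p q. nb p q \<and> lb p = x \<and> lb q = x}"
    then obtain p q where pq: "m = (p, q, closure {p})" "nb p q" "lb p = x" "lb q = x" by blast
    have "morphism (letter_edge x) ((\<lambda>_. q)(0 := p))"
      using pq(2-4) nb_sym[OF pq(2)] unfolding morphism_def by (auto simp: doubleton_eq_iff)
    then show "m \<in> sem (letter_edge x)"
      unfolding pq(1) using cl[OF pq(2)] pq(3,4)
      by (intro semI[of _ "(\<lambda>_. q)(0 := p)"]) (simp_all add: insert_commute)
  }
qed

lemma closure_twins:
  assumes "nb p q" "lb q = lb p"
  shows "closure {p} = closure {q}"
  using closure_insert_twin[of p "{p}" q, OF _ assms]
    closure_insert_twin[of q "{q}" p, OF _ nb_sym[OF assms(1)] assms(2)[symmetric]]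
  by (simp add: insert_commute)

text \<open>
  Seen from one root only, the edge with two equal labels behaves like a single vertex.
\<close>

lemma sem_letter_edge_roots:
  assumes t: "t \<in> letter_trees X"
  defines "E \<equiv> sem (letter_edge (lab t (lroot t)))"
  shows "(\<exists>b. (a, b, C) \<in> E) \<longleftrightarrow> (\<exists>b. (a, b, C) \<in> sem t)"
    and "(\<exists>b. (b, a, C) \<in> E) \<longleftrightarrow> (\<exists>b. (b, a, C) \<in> sem t)"
proof -
  let ?x = "lab t (lroot t)"
  have E: "(a, b, C) \<in> E \<longleftrightarrow> nb a b \<and> lb a = ?x \<and> lb b = ?x \<and> C = closure {a}" for a b C
    unfolding E_def sem_letter_edge by blast
  have T: "(a, b, C) \<in> sem t \<longleftrightarrow> b = a \<and> lb a = ?x \<and> (\<exists>q. nb a q) \<and> C = closure {a}" for a b C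
    unfolding sem_letter_tree[OF t] by blast
  show "(\<exists>b. (a, b, C) \<in> E) \<longleftrightarrow> (\<exists>b. (a, b, C) \<in> sem t)"
    unfolding E T using twin[of a] by metis
  show "(\<exists>b. (b, a, C) \<in> E) \<longleftrightarrow> (\<exists>b. (b, a, C) \<in> sem t)"
  proof
    assume "\<exists>b. (b, a, C) \<in> E"
    then obtain b where b: "nb b a" "lb b = ?x" "lb a = ?x" "C = closure {b}" unfolding E by blast
    then have "C = closure {a}" using closure_twins[OF b(1)] by simp
    then show "\<exists>b. (b, a, C) \<in> sem t" unfolding T using b nb_sym[OF b(1)] by blast
  next
    assume "\<exists>b. (b, a, C) \<in> sem t"
    then obtain q where a: "lb a = ?x" "nb a q" "C = closure {a}" unfolding T by blast
    then obtain b where b: "nb a b" "lb b = lb a" using twin by blast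
    then have "C = closure {b}" using closure_twins[OF b] a by simp
    then show "\<exists>b. (b, a, C) \<in> E" unfolding E using a b nb_sym[OF b(1)] by metis
  qed
qed

lemma smult_iff:
  "(a, d, E) \<in> smult M N \<longleftrightarrow>
    (\<exists>C D. (\<exists>b. (a, b, C) \<in> M) \<and> (\<exists>c. (c, d, D) \<in> N) \<and> nb a d \<and> E = C \<union> D)"
  by (auto simp: smult_def)

lemma smult_cong:
  assumes "\<And>a C. (\<exists>b. (a, b, C) \<in> M) \<longleftrightarrow> (\<exists>b. (a, b, C) \<in> M')"
    and "\<And>a C. (\<exists>b. (b, a, C) \<in> N) \<longleftrightarrow> (\<exists>b. (b, a, C) \<in> N')"
  shows "smult M N = smult M' N'"
proof (rule set_eqI)
  fix x :: "'k \<times> 'k \<times> 'k set"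
  obtain a d E where x: "x = (a, d, E)" by (cases x)
  show "x \<in> smult M N \<longleftrightarrow> x \<in> smult M' N'" unfolding x smult_iff assms ..
qed

end

text \<open>
  In a join only one root of each factor receives the new edge, and only that root matters. Hence a
  one-vertex factor may be replaced by the edge that represents its letter in the algebra.
\<close>

definition grow :: "'a btree \<Rightarrow> 'a btree" where
  "grow t = (if edges t = {} then letter_edge (lab t (lroot t)) else t)"

lemma grow_letter: "t \<in> letter_trees X \<Longrightarrow> grow t = letter_edge (lab t (lroot t))"
  by (simp add: grow_def letter_trees_def)

lemma grow_birooted_tree: "t \<in> birooted_trees X \<Longrightarrow> grow t = t"
  by (auto simp: grow_def birooted_iff)

lemma grow_birooted:
  assumes "t \<in> birooted_trees X \<union> letter_trees X"
  shows "grow t \<in> birooted_trees X"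
  using assms
proof
  assume t: "t \<in> letter_trees X"
  then have "lab t (lroot t) \<in> X" by (simp add: letter_trees_def)
  then show ?thesis unfolding grow_letter[OF t] by (rule letter_edge_birooted)
qed (simp add: grow_birooted_tree)

lemma (in folded_graph) smult_grow:
  assumes "t \<in> birooted_trees X \<union> letter_trees X"
  shows "smult (sem (grow t)) M = smult (sem t) M" "smult M (sem (grow t)) = smult M (sem t)"
proof -
  consider "grow t = t" | "t \<in> letter_trees X" "grow t = letter_edge (lab t (lroot t))"
    using assms grow_birooted_tree grow_letter by blast
  then show "smult (sem (grow t)) M = smult (sem t) M" "smult M (sem (grow t)) = smult M (sem t)"
    by (cases; simp add: smult_cong[OF sem_letter_edge_roots(1) refl]
        smult_cong[OF refl sem_letter_edge_roots(2)])+
qed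

text \<open>
  Induction over birooted trees. The statement is extended to one-vertex trees by \<open>grow\<close>.
\<close>

theorem reduced_trees_generated:
  assumes letters: "letter ` X \<subseteq> B"
    and closed: "\<And>\<alpha> \<beta>. \<alpha> \<in> \<AA> X \<Longrightarrow> \<beta> \<in> \<AA> X \<Longrightarrow> \<alpha> \<in> B \<Longrightarrow> \<beta> \<in> B \<Longrightarrow> \<alpha> \<and>\<^sub>T \<beta> \<in> B"
  shows "\<AA> X \<subseteq> B"
proof -
  have "reduced_form (grow t) \<in> B" if "t \<in> birooted_trees X \<union> letter_trees X" for t
    using that
  proof (induction rule: birooted_induct)
    case (letter t)
    then have "lab t (lroot t) \<in> X" by (simp add: letter_trees_def)
    then have "letter (lab t (lroot t)) \<in> B" "letter (lab t (lroot t)) = reduced_form (grow t)"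
      using letters letter_reduced_form[of _ X] grow_letter[OF letter] by auto
    then show ?case by simp
  next
    case (join s t)
    have g: "grow s \<in> birooted_trees X" "grow t \<in> birooted_trees X"
      using join.hyps by (auto intro: grow_birooted)
    have st: "s \<sqinter>\<^sub>T t \<in> birooted_trees X" using join.hyps by (rule join_birooted)
    have "words.sem (s \<sqinter>\<^sub>T t) = words.sem (grow s \<sqinter>\<^sub>T grow t)"
      unfolding words.sem_join 
      by (simp only: words.smult_grow(1)[OF join.hyps(1)] words.smult_grow(2)[OF join.hyps(2)])
    then have "reduced_form (s \<sqinter>\<^sub>T t) = reduced_form (grow s) \<and>\<^sub>T reduced_form (grow t)"
      unfolding wedge_reduced_form[OF g] by (rule reduced_form_cong[OF st join_birooted'[OF g]])
    moreover have "reduced_form (grow s) \<in> \<AA> X" "reduced_form (grow t) \<in> \<AA> X"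
      using g unfolding reduced_trees_eq by blast+
    ultimately show ?case using closed join.IH grow_birooted_tree[OF st] by simp
  next
    case (iso s t)
    have "reduced_form s = reduced_form t"
      using iso.hyps words.sem_iso[OF iso(3,1)] by (intro reduced_form_cong)
    then show ?case using iso.IH iso.hyps by (simp add: grow_birooted_tree)
  qed
  then show ?thesis unfolding reduced_trees_eq using grow_birooted_tree by fastforce
qed

section \<open>Pseudosemilattices\<close>

context pseudosemilattice
begin

lemma opposite: "pseudosemilattice S (\<lambda>x y. y \<cdot> x)"
  by unfold_locales (rule closed PS1 PS2 PS3 PS2' PS3'; assumption)+

lemma left_absorb: "x \<in> S \<Longrightarrow> y \<in> S \<Longrightarrow> x \<cdot> (x \<cdot> y) = x \<cdot> y"
  using PS2[of x x y] by (simp add: PS1)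

text \<open>
  Transitivity of left absorption. The second identity only yields \<open>g = x \<cdot> (z \<cdot> g)\<close>, a product of two
  elements absorbed by \<open>z\<close>; the third one lets \<open>z\<close> absorb this product.
\<close>

lemma left_trans:
  assumes "x \<in> S" "z \<in> S" "g \<in> S" and zx: "z \<cdot> x = x" and xg: "x \<cdot> g = g"
  shows "z \<cdot> g = g"
proof -
  have "x \<cdot> (z \<cdot> g) = g" using PS2[of z x g] assms by simp
  then show ?thesis using PS3[of z z x g] assms by (simp add: PS1)
qed

text \<open>
  By \<open>left_absorb\<close> and its dual the product \<open>x \<cdot> y\<close> is itself absorbed by \<open>x\<close> on the left and by \<open>y\<close> on
  the right, so it is the largest such element.
\<close>

lemma below_product:
  assumes "x \<in> S" "y \<in> S" "g \<in> S" and xg: "x \<cdot> g = g" and gy: "g \<cdot> y = g"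
  shows "(x \<cdot> y) \<cdot> g = g" "g \<cdot> (x \<cdot> y) = g"
proof -
  have "(x \<cdot> y) \<cdot> g = x \<cdot> (g \<cdot> y)" using PS2'[of y g x] assms by simp
  then show "(x \<cdot> y) \<cdot> g = g" using assms by simp
  show "g \<cdot> (x \<cdot> y) = g" using PS2[of x g y] assms by simp
qed

text \<open>
  If \<open>v\<close> absorbs \<open>g\<close> on the left, then \<open>g \<cdot> v\<close> is equivalent to \<open>g\<close> for left absorption, hence also
  absorbed by \<open>v\<close> on the left, and on the right it is absorbed by \<open>v\<close> in any case. This is how an edge is
  moved to another right end without moving its left end.
\<close>

lemma restrict_right:
  assumes "v \<in> S" "g \<in> S" and vg: "v \<cdot> g = g"
  shows "v \<cdot> (g \<cdot> v) = g \<cdot> v" "(g \<cdot> v) \<cdot> g = g" "g \<cdot> (g \<cdot> v) = g \<cdot> v"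
proof -
  show 1: "g \<cdot> (g \<cdot> v) = g \<cdot> v" using assms by (simp add: left_absorb)
  show "v \<cdot> (g \<cdot> v) = g \<cdot> v" using left_trans[OF _ _ _ vg 1] assms closed by simp
  show "(g \<cdot> v) \<cdot> g = g" using PS3[of v g v g] assms by (simp add: PS1)
qed

text \<open>
  This is what makes the graph of \<open>S\<close> folded: an edge is determined by its left end and the label of
  its right end.
\<close>

lemma left_equivalent_eq:
  assumes "x \<in> S" "g \<in> S" "h \<in> S" and gh: "g \<cdot> h = h" "h \<cdot> g = g" and x: "g \<cdot> x = g" "h \<cdot> x = h"
  shows "g = h"
proof -
  have "h \<cdot> (g \<cdot> x) = h" using below_product(2)[of g x h] assms by simp
  then show ?thesis using assms by simp
qed

lemmas right_absorb = pseudosemilattice.left_absorb[OF opposite]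
  and right_trans = pseudosemilattice.left_trans[OF opposite]
  and restrict_left = pseudosemilattice.restrict_right[OF opposite]
  and right_equivalent_eq = pseudosemilattice.left_equivalent_eq[OF opposite]

definition Rclass :: "'b \<Rightarrow> 'b set" where
  "Rclass g = {h \<in> S. g \<cdot> h = h \<and> h \<cdot> g = g}"

definition Lclass :: "'b \<Rightarrow> 'b set" where
  "Lclass g = {h \<in> S. h \<cdot> g = h \<and> g \<cdot> h = g}"

lemma Rclass_eq_iff:
  assumes "g \<in> S" "h \<in> S"
  shows "Rclass g = Rclass h \<longleftrightarrow> g \<cdot> h = h \<and> h \<cdot> g = g"
proof
  assume "Rclass g = Rclass h"
  moreover have "h \<in> Rclass h" using assms by (simp add: Rclass_def PS1)
  ultimately have "h \<in> Rclass g" by simp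
  then show "g \<cdot> h = h \<and> h \<cdot> g = g" by (simp add: Rclass_def)
next
  assume gh: "g \<cdot> h = h \<and> h \<cdot> g = g"
  have "k \<in> Rclass g \<longleftrightarrow> k \<in> Rclass h" for k
    unfolding Rclass_def mem_Collect_eq using gh assms left_trans by metis
  then show "Rclass g = Rclass h" by blast
qed

lemma Lclass_opposite: "Lclass = pseudosemilattice.Rclass S (\<lambda>x y. y \<cdot> x)"
  by (simp add: fun_eq_iff Lclass_def pseudosemilattice.Rclass_def[OF opposite])

lemma Lclass_eq_iff:
  assumes "g \<in> S" "h \<in> S"
  shows "Lclass g = Lclass h \<longleftrightarrow> h \<cdot> g = h \<and> g \<cdot> h = g"
  using pseudosemilattice.Rclass_eq_iff[OF opposite assms] unfolding Lclass_opposite .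

end

section \<open>Evaluating trees in a pseudosemilattice\<close>

text \<open>
  An element \<open>g\<close> with \<open>f x \<cdot> g = g\<close> and \<open>g \<cdot> f y = g\<close> is drawn as an edge from a left vertex
  labelled \<open>x\<close> to a right vertex labelled \<open>y\<close>. Two such edges with the same \<open>x\<close> share their left vertex if
  the elements are equivalent for left absorption, and dually. The result is a folded graph with
  twins, so the images of the root edge of a tree under morphisms survive reduction; they turn
  out to be the elements below one element, the value of the tree.
\<close>

text \<open>The Boolean tells left ends from right ends.\<close>

type_synonym ('a, 'b) end_point = "bool \<times> 'a \<times> 'b set"

locale evaluation = pseudosemilattice S mult
  for S :: "'b set" and mult :: "'b \<Rightarrow> 'b \<Rightarrow> 'b"  (infixl "\<cdot>" 70) +
  fixes X :: "'a set" and f :: "'a \<Rightarrow> 'b"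
  assumes f: "x \<in> X \<Longrightarrow> f x \<in> S"
begin

definition lend :: "'a \<Rightarrow> 'b \<Rightarrow> ('a, 'b) end_point" where "lend x g = (True, x, Rclass g)"
definition rend :: "'a \<Rightarrow> 'b \<Rightarrow> ('a, 'b) end_point" where "rend y g = (False, y, Lclass g)"

definition fits :: "'a \<Rightarrow> 'a \<Rightarrow> 'b \<Rightarrow> bool" where
  "fits x y g \<longleftrightarrow> x \<in> X \<and> y \<in> X \<and> g \<in> S \<and> f x \<cdot> g = g \<and> g \<cdot> f y = g"

definition enb :: "('a, 'b) end_point \<Rightarrow> ('a, 'b) end_point \<Rightarrow> bool" where
  "enb p q \<longleftrightarrow> (\<exists>x y g. fits x y g \<and>
    ((p = lend x g \<and> q = rend y g) \<or> (p = rend y g \<and> q = lend x g)))"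

definition elab :: "('a, 'b) end_point \<Rightarrow> 'a" where "elab p = fst (snd p)"

lemma elab_simps [simp]: "elab (lend x g) = x" "elab (rend x g) = x"
  by (simp_all add: elab_def lend_def rend_def)

lemma end_eq:
  "lend x g = lend x' g' \<longleftrightarrow> x = x' \<and> Rclass g = Rclass g'"
  "rend x g = rend x' g' \<longleftrightarrow> x = x' \<and> Lclass g = Lclass g'"
  "lend x g \<noteq> rend x' g'" "rend x' g' \<noteq> lend x g"
  by (auto simp: lend_def rend_def)

lemma enbI: "fits x y g \<Longrightarrow> enb (lend x g) (rend y g)" "fits x y g \<Longrightarrow> enb (rend y g) (lend x g)"
  unfolding enb_def by blast+

lemma enb_lend:
  assumes "enb (lend x g) q" "g \<in> S"
  obtains y h where "fits x y h" "q = rend y h" "g \<cdot> h = h" "h \<cdot> g = g" "lend x h = lend x g"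
proof -
  obtain x' y h where h: "fits x' y h" "lend x g = lend x' h" "q = rend y h"
    using assms(1) unfolding enb_def by (auto simp: end_eq)
  moreover have "h \<in> S" using h(1) by (simp add: fits_def)
  ultimately show thesis
    using that[of y h] assms(2) by (simp add: end_eq Rclass_eq_iff)
qed

lemma enb_rend:
  assumes "enb (rend y g) p" "g \<in> S"
  obtains x h where "fits x y h" "p = lend x h" "g \<cdot> h = g" "h \<cdot> g = h" "rend y h = rend y g"
proof -
  obtain x y' h where h: "fits x y' h" "rend y g = rend y' h" "p = lend x h"
    using assms(1) unfolding enb_def by (auto simp: end_eq)
  moreover have "h \<in> S" using h(1) by (simp add: fits_def)
  ultimately show thesis
    using that[of x h] assms(2) by (simp add: end_eq Lclass_eq_iff)
qed

lemma restrict_right_fits: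
  assumes "fits x y g" "v \<in> S" "v \<cdot> g = g" "f x \<cdot> v = v" "v \<cdot> f z = v" "z \<in> X"
  shows "fits x z (g \<cdot> v)" "lend x (g \<cdot> v) = lend x g"
proof -
  have g: "g \<in> S" "g \<cdot> v \<in> S" "x \<in> X" using assms closed by (auto simp: fits_def)
  note r = restrict_right[OF assms(2) g(1) assms(3)]
  have "f x \<cdot> (g \<cdot> v) = g \<cdot> v"
    using left_trans[OF assms(2) f[OF g(3)] g(2) assms(4) r(1)] .
  moreover have "(g \<cdot> v) \<cdot> f z = g \<cdot> v"
    using right_trans[OF assms(2) f[OF assms(6)] g(2) assms(5)] right_absorb[OF assms(2) g(1)] by simp
  ultimately show "fits x z (g \<cdot> v)" using g assms(6) by (simp add: fits_def)
  show "lend x (g \<cdot> v) = lend x g"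
    using r g by (simp add: end_eq Rclass_eq_iff)
qed

lemma restrict_left_fits:
  assumes "fits x y g" "v \<in> S" "g \<cdot> v = g" "f z \<cdot> v = v" "v \<cdot> f y = v" "z \<in> X"
  shows "fits z y (v \<cdot> g)" "rend y (v \<cdot> g) = rend y g"
proof -
  have g: "g \<in> S" "v \<cdot> g \<in> S" "y \<in> X" using assms closed by (auto simp: fits_def)
  note r = restrict_left[OF assms(2) g(1) assms(3)]
  have "(v \<cdot> g) \<cdot> f y = v \<cdot> g"
    using right_trans[OF assms(2) f[OF g(3)] g(2) assms(5) r(1)] .
  moreover have "f z \<cdot> (v \<cdot> g) = v \<cdot> g"
    using left_trans[OF assms(2) f[OF assms(6)] g(2) assms(4)] left_absorb[OF assms(2) g(1)] by simp
  ultimately show "fits z y (v \<cdot> g)" using g assms(6) by (simp add: fits_def)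
  show "rend y (v \<cdot> g) = rend y g"
    using r g by (simp add: end_eq Lclass_eq_iff)
qed

lemma letter_idem: "x \<in> X \<Longrightarrow> f x \<in> S \<and> f x \<cdot> f x = f x"
  using f PS1 by blast

sublocale graph: folded_graph enb elab
proof
  fix p q assume "enb p q"
  then show "enb q p" unfolding enb_def by blast
next
  fix p q q' assume e: "enb p q" "enb p q'" "elab q = elab q'"
  from e(1) obtain x y g where g: "fits x y g"
    "p = lend x g \<and> q = rend y g \<or> p = rend y g \<and> q = lend x g" unfolding enb_def by blast
  then have gS: "g \<in> S" by (simp add: fits_def)
  from g(2) show "q = q'"
  proof
    assume p: "p = lend x g \<and> q = rend y g"
    then have "enb (lend x g) q'" using e(2) by simp
    then obtain y' h where h: "fits x y' h" "q' = rend y' h" "g \<cdot> h = h" "h \<cdot> g = g"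
      using gS by (rule enb_lend)
    have "y' = y" using p h(2) e(3) by simp
    then have "g = h"
      using left_equivalent_eq[of "f y" g h] g(1) h f by (simp add: fits_def)
    then show ?thesis using p h(2) \<open>y' = y\<close> by simp
  next
    assume p: "p = rend y g \<and> q = lend x g"
    then have "enb (rend y g) q'" using e(2) by simp
    then obtain x' h where h: "fits x' y h" "q' = lend x' h" "g \<cdot> h = g" "h \<cdot> g = h"
      using gS by (rule enb_rend)
    have "x' = x" using p h(2) e(3) by simp
    then have "g = h"
      using right_equivalent_eq[of "f x" g h] g(1) h f by (simp add: fits_def)
    then show ?thesis using p h(2) \<open>x' = x\<close> by simp
  qed
next
  fix p q assume "enb p q"
  then obtain x y g where g: "fits x y g"
    "p = lend x g \<and> q = rend y g \<or> p = rend y g \<and> q = lend x g" unfolding enb_def by blast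
  then have xy: "x \<in> X" "y \<in> X" by (simp_all add: fits_def)
  from g(2) show "\<exists>p'. enb p p' \<and> elab p' = elab p"
  proof
    assume "p = lend x g \<and> q = rend y g"
    moreover have "fits x x (g \<cdot> f x)" "lend x (g \<cdot> f x) = lend x g"
      using restrict_right_fits[of x y g "f x" x] g(1) xy letter_idem by (simp_all add: fits_def)
    ultimately show ?thesis using enbI(1)[of x x "g \<cdot> f x"] by (intro exI[of _ "rend x (g \<cdot> f x)"]) simp
  next
    assume "p = rend y g \<and> q = lend x g"
    moreover have "fits y y (f y \<cdot> g)" "rend y (f y \<cdot> g) = rend y g"
      using restrict_left_fits[of x y g "f y" y] g(1) xy letter_idem by (simp_all add: fits_def)
    ultimately show ?thesis using enbI(2)[of y y "f y \<cdot> g"] by (intro exI[of _ "lend y (f y \<cdot> g)"]) simp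
  qed
qed

text \<open>
  The last two clauses describe the elements below \<open>v\<close> from each end separately: the left root can be
  sent to the left end of \<open>g\<close> iff \<open>v\<close> absorbs \<open>g\<close> on the left, and dually. In this form the notion
  also makes sense for one-vertex trees.
\<close>

definition has_value :: "'a btree \<Rightarrow> 'b \<Rightarrow> bool" where
  "has_value t v \<longleftrightarrow> v \<in> S \<and> f (lab t (lroot t)) \<cdot> v = v \<and> v \<cdot> f (lab t (rroot t)) = v
    \<and> (\<forall>g \<in> S. f (lab t (lroot t)) \<cdot> g = g \<longrightarrow>
        ((\<exists>b C. (lend (lab t (lroot t)) g, b, C) \<in> graph.sem t) \<longleftrightarrow> v \<cdot> g = g))
    \<and> (\<forall>g \<in> S. g \<cdot> f (lab t (rroot t)) = g \<longrightarrow>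
        ((\<exists>a C. (a, rend (lab t (rroot t)) g, C) \<in> graph.sem t) \<longleftrightarrow> g \<cdot> v = g))"

lemma has_valueD:
  assumes "has_value t v"
  shows "v \<in> S" "f (lab t (lroot t)) \<cdot> v = v" "v \<cdot> f (lab t (rroot t)) = v"
    "g \<in> S \<Longrightarrow> f (lab t (lroot t)) \<cdot> g = g \<Longrightarrow>
      (\<exists>b C. (lend (lab t (lroot t)) g, b, C) \<in> graph.sem t) \<longleftrightarrow> v \<cdot> g = g"
    "g \<in> S \<Longrightarrow> g \<cdot> f (lab t (rroot t)) = g \<Longrightarrow>
      (\<exists>a C. (a, rend (lab t (rroot t)) g, C) \<in> graph.sem t) \<longleftrightarrow> g \<cdot> v = g"
  using assms unfolding has_value_def by blast+

text \<open>
  A value absorbs itself, so by the description that it shares with any other value of the tree it is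
  absorbed by that one, on either side.
\<close>

lemma has_value_unique:
  assumes v: "has_value t v" and w: "has_value t w"
  shows "v = w"
proof -
  have "v \<cdot> w = w" "w \<cdot> v = v"
    using has_valueD(4)[OF v, of w] has_valueD(4)[OF w, of w]
      has_valueD(4)[OF v, of v] has_valueD(4)[OF w, of v]
      has_valueD(1,2)[OF v] has_valueD(1,2)[OF w] PS1 by simp_all
  moreover have "v \<cdot> w = v"
    using has_valueD(5)[OF v, of v] has_valueD(5)[OF w, of v]
      has_valueD(1,3)[OF v] PS1 by simp
  ultimately show ?thesis by simp
qed

lemma has_value_cong:
  assumes "has_value t v" "graph.sem u = graph.sem t" "lab u (lroot u) = lab t (lroot t)"
    "lab u (rroot u) = lab t (rroot t)"
  shows "has_value u v"
  using assms unfolding has_value_def by simp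

lemma lend_neighbour:
  assumes "x \<in> X" "g \<in> S" "f x \<cdot> g = g"
  shows "\<exists>q. enb (lend x g) q \<and> elab q = x"
proof -
  have "fits x x (g \<cdot> f x)" "lend x (g \<cdot> f x) = lend x g"
    using restrict_right_fits[of x x g "f x" x] assms letter_idem closed
      restrict_right[of "f x" g] right_absorb[of "f x" g] Rclass_eq_iff[of "g \<cdot> f x" g] f
    by (simp_all add: fits_def end_eq)
  then show ?thesis using enbI(1)[of x x "g \<cdot> f x"] by (intro exI[of _ "rend x (g \<cdot> f x)"]) simp
qed

lemma rend_neighbour:
  assumes "x \<in> X" "g \<in> S" "g \<cdot> f x = g"
  shows "\<exists>q. enb (rend x g) q \<and> elab q = x"
proof -
  have "fits x x (f x \<cdot> g)" "rend x (f x \<cdot> g) = rend x g"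
    using assms letter_idem closed
      restrict_left[of "f x" g] left_absorb[of "f x" g] Lclass_eq_iff[of "f x \<cdot> g" g] f
    by (simp_all add: fits_def end_eq)
  then show ?thesis using enbI(2)[of x x "f x \<cdot> g"] by (intro exI[of _ "lend x (f x \<cdot> g)"]) simp
qed

lemma has_value_letter_edge:
  assumes x: "x \<in> X"
  shows "has_value (letter_edge x) (f x)"
proof -
  have "\<exists>b C. (lend x g, b, C) \<in> graph.sem (letter_edge x)" if g: "g \<in> S" "f x \<cdot> g = g" for g
  proof -
    obtain q where q: "enb (lend x g) q" "elab q = x" using lend_neighbour[OF x g] by blast
    then have "(lend x g, q, graph.closure {lend x g}) \<in> graph.sem (letter_edge x)"
      unfolding graph.sem_letter_edge by (intro CollectI exI[of _ "lend x g"] exI[of _ q]) simp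
    then show ?thesis by blast
  qed
  moreover have "\<exists>a C. (a, rend x g, C) \<in> graph.sem (letter_edge x)" if g: "g \<in> S" "g \<cdot> f x = g" for g
  proof -
    obtain q where q: "enb (rend x g) q" "elab q = x" using rend_neighbour[OF x g] by blast
    then have "(q, rend x g, graph.closure {q}) \<in> graph.sem (letter_edge x)"
      unfolding graph.sem_letter_edge using graph.nb_sym[OF q(1)]
      by (intro CollectI exI[of _ q] exI[of _ "rend x g"]) simp
    then show ?thesis by blast
  qed
  ultimately show ?thesis
    unfolding has_value_def using letter_idem[OF x] by simp
qed

lemma has_value_letter_tree:
  assumes t: "t \<in> letter_trees X"
  shows "has_value t (f (lab t (lroot t)))"
proof -
  let ?x = "lab t (lroot t)"
  have x: "?x \<in> X" "rroot t = lroot t" using t by (auto simp: letter_trees_def)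
  have "(\<exists>b C. (a, b, C) \<in> graph.sem (letter_edge ?x)) \<longleftrightarrow> (\<exists>b C. (a, b, C) \<in> graph.sem t)"
    "(\<exists>b C. (b, a, C) \<in> graph.sem (letter_edge ?x)) \<longleftrightarrow> (\<exists>b C. (b, a, C) \<in> graph.sem t)" for a
    using graph.sem_letter_edge_roots[OF t, of a] by metis+
  then show ?thesis
    using has_value_letter_edge[OF x(1)] unfolding has_value_def by (simp add: x(2))
qed

text \<open>
  An element can label the new root edge iff it lies below both factors on the appropriate sides, that
  is, below their product (\<open>below_product\<close>). An arbitrary \<open>g\<close> that is absorbed by the product on one
  side is first restricted so that it is absorbed on both.
\<close>

lemma has_value_join:
  assumes s: "s \<in> birooted_trees X \<union> letter_trees X" and t: "t \<in> birooted_trees X \<union> letter_trees X"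
    and v: "has_value s v" and w: "has_value t w"
  shows "has_value (s \<sqinter>\<^sub>T t) (v \<cdot> w)"
proof -
  define x where "x = lab s (lroot s)"
  define y where "y = lab t (rroot t)"
  have xy: "x \<in> X" "y \<in> X" using treeD(2-4)[OF s] treeD(2-4)[OF t] unfolding x_def y_def by auto
  note V = has_valueD[OF v, folded x_def] and W = has_valueD[OF w, folded y_def]
  have vwS: "v \<cdot> w \<in> S" using V(1) W(1) closed by blast
  have vvw: "v \<cdot> (v \<cdot> w) = v \<cdot> w" using left_absorb V(1) W(1) by blast
  have vww: "(v \<cdot> w) \<cdot> w = v \<cdot> w" using right_absorb V(1) W(1) by blast
  have xvw: "f x \<cdot> (v \<cdot> w) = v \<cdot> w" using left_trans[OF V(1) f[OF xy(1)] vwS V(2) vvw] .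
  have vwy: "(v \<cdot> w) \<cdot> f y = v \<cdot> w" using right_trans[OF W(1) f[OF xy(2)] vwS W(3) vww] .
  \<comment> \<open>an element labels the new root edge iff it lies below the product\<close>
  have sound: "(v \<cdot> w) \<cdot> g = g \<and> g \<cdot> (v \<cdot> w) = g"
    if g: "fits x y g" "(lend x g, b, C) \<in> graph.sem s" "(c, rend y g, D) \<in> graph.sem t" for g b C c D
  proof -
    have gS: "g \<in> S" "f x \<cdot> g = g" "g \<cdot> f y = g" using g(1) by (simp_all add: fits_def)
    have "v \<cdot> g = g" using V(4)[OF gS(1,2)] g(2) unfolding x_def by blast
    moreover have "g \<cdot> w = g" using W(5)[OF gS(1,3)] g(3) unfolding y_def by blast
    ultimately show ?thesis using below_product[OF V(1) W(1) gS(1)] by blast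
  qed
  have complete: "(\<exists>b C. (lend x g, b, C) \<in> graph.sem s) \<and> (\<exists>c D. (c, rend y g, D) \<in> graph.sem t)"
    if g: "g \<in> S" "(v \<cdot> w) \<cdot> g = g" "g \<cdot> (v \<cdot> w) = g" for g
  proof -
    have "v \<cdot> g = g" using left_trans[OF vwS V(1) g(1) vvw g(2)] .
    moreover have "f x \<cdot> g = g" using left_trans[OF vwS f[OF xy(1)] g(1) xvw g(2)] .
    moreover have "g \<cdot> w = g" using right_trans[OF vwS W(1) g(1) vww g(3)] .
    moreover have "g \<cdot> f y = g" using right_trans[OF vwS f[OF xy(2)] g(1) vwy g(3)] .
    ultimately show ?thesis using V(4)[OF g(1)] W(5)[OF g(1)] unfolding x_def y_def by blast
  qed
  have lab_c: "elab d = y" if "(c, d, D) \<in> graph.sem t" for c d D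
    using that graph.morphismD(1) treeD(4)[OF t] unfolding y_def by (auto elim!: graph.semE)
  have lab_a: "elab a = x" if "(a, b, C) \<in> graph.sem s" for a b C
    using that graph.morphismD(1) treeD(3)[OF s] unfolding x_def by (auto elim!: graph.semE)
  have left: "(\<exists>d E. (lend x g, d, E) \<in> graph.sem (s \<sqinter>\<^sub>T t)) \<longleftrightarrow> (v \<cdot> w) \<cdot> g = g"
    if g: "g \<in> S" "f x \<cdot> g = g" for g
  proof
    assume "\<exists>d E. (lend x g, d, E) \<in> graph.sem (s \<sqinter>\<^sub>T t)"
    then obtain b C c d D where m: "(lend x g, b, C) \<in> graph.sem s" "(c, d, D) \<in> graph.sem t"
      "enb (lend x g) d" unfolding graph.sem_join by (auto elim: graph.smultE)
    obtain y' h where h: "fits x y' h" "d = rend y' h" "g \<cdot> h = h" "h \<cdot> g = g" "lend x h = lend x g"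
      using m(3) g(1) by (rule enb_lend)
    have "y' = y" using lab_c[OF m(2)] h(2) by simp
    then have "(v \<cdot> w) \<cdot> h = h" using sound[of h] h m by simp
    moreover have "h \<in> S" using h(1) by (simp add: fits_def)
    ultimately show "(v \<cdot> w) \<cdot> g = g" using left_trans[OF _ vwS g(1) _ h(4)] by blast
  next
    assume vwg: "(v \<cdot> w) \<cdot> g = g"
    let ?h = "g \<cdot> (v \<cdot> w)"
    have hS: "?h \<in> S" using g(1) vwS closed by blast
    note r = restrict_right[OF vwS g(1) vwg]
    have hvw: "?h \<cdot> (v \<cdot> w) = ?h" using right_absorb[OF vwS g(1)] .
    have le: "lend x ?h = lend x g" using r hS g(1) by (simp add: end_eq Rclass_eq_iff)
    obtain b C c D where "(lend x g, b, C) \<in> graph.sem s" "(c, rend y ?h, D) \<in> graph.sem t"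
      using complete[OF hS r(1) hvw] le by auto
    moreover have "fits x y ?h"
      using left_trans[OF vwS f[OF xy(1)] hS xvw r(1)] right_trans[OF vwS f[OF xy(2)] hS vwy hvw] xy hS
      by (simp add: fits_def)
    then have "enb (lend x g) (rend y ?h)" using enbI(1) le by metis
    ultimately show "\<exists>d E. (lend x g, d, E) \<in> graph.sem (s \<sqinter>\<^sub>T t)"
      unfolding graph.sem_join using graph.smultI by blast
  qed
  have right: "(\<exists>a E. (a, rend y g, E) \<in> graph.sem (s \<sqinter>\<^sub>T t)) \<longleftrightarrow> g \<cdot> (v \<cdot> w) = g"
    if g: "g \<in> S" "g \<cdot> f y = g" for g
  proof
    assume "\<exists>a E. (a, rend y g, E) \<in> graph.sem (s \<sqinter>\<^sub>T t)"
    then obtain a b C c D where m: "(a, b, C) \<in> graph.sem s" "(c, rend y g, D) \<in> graph.sem t"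
      "enb a (rend y g)" unfolding graph.sem_join by (auto elim: graph.smultE)
    obtain x' h where h: "fits x' y h" "a = lend x' h" "g \<cdot> h = g" "h \<cdot> g = h" "rend y h = rend y g"
      using graph.nb_sym[OF m(3)] g(1) by (rule enb_rend)
    have "x' = x" using lab_a[OF m(1)] h(2) by simp
    then have "h \<cdot> (v \<cdot> w) = h" using sound[of h] h m by simp
    moreover have "h \<in> S" using h(1) by (simp add: fits_def)
    ultimately show "g \<cdot> (v \<cdot> w) = g" using right_trans[OF _ vwS g(1) _ h(3)] by blast
  next
    assume vwg: "g \<cdot> (v \<cdot> w) = g"
    let ?h = "(v \<cdot> w) \<cdot> g"
    have hS: "?h \<in> S" using g(1) vwS closed by blast
    note r = restrict_left[OF vwS g(1) vwg]
    have hvw: "(v \<cdot> w) \<cdot> ?h = ?h" using left_absorb[OF vwS g(1)] .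
    have re: "rend y ?h = rend y g" using r hS g(1) by (simp add: end_eq Lclass_eq_iff)
    obtain b C c D where "(lend x ?h, b, C) \<in> graph.sem s" "(c, rend y g, D) \<in> graph.sem t"
      using complete[OF hS hvw r(1)] re by auto
    moreover have "fits x y ?h"
      using left_trans[OF vwS f[OF xy(1)] hS xvw hvw] right_trans[OF vwS f[OF xy(2)] hS vwy r(1)] xy hS
      by (simp add: fits_def)
    then have "enb (lend x ?h) (rend y g)" using enbI(1) re by metis
    ultimately show "\<exists>a E. (a, rend y g, E) \<in> graph.sem (s \<sqinter>\<^sub>T t)"
      unfolding graph.sem_join using graph.smultI by blast
  qed
  show ?thesis
    unfolding has_value_def join_simps x_def[symmetric] y_def[symmetric]
    using vwS xvw vwy left right by blast
qed

lemma has_value_exists: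
  assumes "t \<in> birooted_trees X \<union> letter_trees X"
  shows "\<exists>v. has_value t v"
  using assms
proof (induction rule: birooted_induct)
  case (letter t)
  then show ?case using has_value_letter_tree by blast
next
  case (join s t)
  then show ?case using has_value_join by blast
next
  case (iso s t)
  then show ?case
    using has_value_cong graph.sem_iso[OF iso(3,1)] tree_iso_root_labels[OF iso(3,1)]
    by metis
qed

end

section \<open>Freeness\<close>

lemma reduces_rtrancl_root_labels:
  assumes "reduces\<^sup>*\<^sup>* t u" "t \<in> birooted_trees X"
  shows "u \<in> birooted_trees X \<and> lab u (lroot u) = lab t (lroot t) \<and> lab u (rroot u) = lab t (rroot t)"
  using assms(1)
proof (induction rule: rtranclp_induct)
  case base
  show ?case using assms(2) by simp
next
  case (step y z)
  then show ?case using reduces_birooted(1,3,4)[OF step(2)] by metis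
qed

lemma reduced_form_eqD:
  assumes s: "s \<in> birooted_trees X" and t: "t \<in> birooted_trees X"
    and eq: "reduced_form s = reduced_form t"
  shows "lab s (lroot s) = lab t (lroot t)" "lab s (rroot s) = lab t (rroot t)"
    and "folded_graph nb lb \<Longrightarrow> folded_graph.sem nb lb s = folded_graph.sem nb lb t"
proof -
  obtain s' where s': "s' \<in> birooted_trees X" "reduces\<^sup>*\<^sup>* s s'" "reduced_form s = iso_class s'"
    using s by (rule reduced_formE) blast
  obtain t' where t': "t' \<in> birooted_trees X" "reduces\<^sup>*\<^sup>* t t'" "reduced_form t = iso_class t'"
    using t by (rule reduced_formE) blast
  have i: "(s', t') \<in> tree_iso"
    using eq s'(3) t'(3) tree_iso_refl[of t'] mem_iso_class by metis
  show "lab s (lroot s) = lab t (lroot t)" "lab s (rroot s) = lab t (rroot t)"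
    using tree_iso_root_labels[OF i s'(1)] reduces_rtrancl_root_labels[OF s'(2) s]
      reduces_rtrancl_root_labels[OF t'(2) t] by simp_all
  assume "folded_graph nb lb"
  then interpret folded_graph nb lb .
  show "sem s = sem t"
    using sem_iso[OF i s'(1)] sem_reduces_rtrancl[OF s'(2) s] sem_reduces_rtrancl[OF t'(2) t] by simp
qed

text \<open>
  The homomorphism sends a class to the value of any tree with that reduced form.
\<close>

lemma (in evaluation) universal_property:
  "\<exists>!h. h \<in> \<AA> X \<rightarrow>\<^sub>E S \<and> (\<forall>\<alpha> \<in> \<AA> X. \<forall>\<beta> \<in> \<AA> X. h (\<alpha> \<and>\<^sub>T \<beta>) = h \<alpha> \<cdot> h \<beta>) \<and> (\<forall>x \<in> X. h (letter x) = f x)"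
proof -
  let ?B = "birooted_trees X"
  define val where "val t = (THE v. has_value t v)" for t
  have valI: "val t = v" if "has_value t v" for t v
    unfolding val_def using that has_value_unique by blast
  have val: "has_value t (val t)" if "t \<in> ?B" for t
    using has_value_exists[of t] valI that by blast
  define h where "h = restrict (\<lambda>\<alpha>. val (SOME t. t \<in> ?B \<and> reduced_form t = \<alpha>)) (\<AA> X)"
  have h: "h (reduced_form t) = val t" if t: "t \<in> ?B" for t
  proof -
    let ?u = "SOME u. u \<in> ?B \<and> reduced_form u = reduced_form t"
    have u: "?u \<in> ?B \<and> reduced_form ?u = reduced_form t"
      by (rule someI[of _ t]) (simp add: t)
    note e = reduced_form_eqD[OF conjunct1[OF u] t conjunct2[OF u]]
    have "has_value ?u (val t)"
      using has_value_cong[OF val[OF t]] e(1,2) e(3)[OF graph.folded_graph_axioms] by simp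
    moreover have "reduced_form t \<in> \<AA> X" using t unfolding reduced_trees_eq by (rule imageI)
    ultimately show ?thesis unfolding h_def using valI by simp
  qed
  have h_fun: "h \<in> \<AA> X \<rightarrow>\<^sub>E S"
  proof (rule PiE_I)
    fix \<alpha> assume "\<alpha> \<in> \<AA> X"
    then obtain t where t: "t \<in> ?B" "\<alpha> = reduced_form t" unfolding reduced_trees_eq by blast
    then show "h \<alpha> \<in> S" using h has_valueD(1)[OF val] by simp
  qed (simp add: h_def)
  have h_hom: "h (\<alpha> \<and>\<^sub>T \<beta>) = h \<alpha> \<cdot> h \<beta>" if \<alpha>\<beta>: "\<alpha> \<in> \<AA> X" "\<beta> \<in> \<AA> X" for \<alpha> \<beta>
  proof -
    obtain s t where st: "s \<in> ?B" "t \<in> ?B" "\<alpha> = reduced_form s" "\<beta> = reduced_form t"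
      using \<alpha>\<beta> unfolding reduced_trees_eq by blast
    have "has_value (s \<sqinter>\<^sub>T t) (val s \<cdot> val t)"
      using has_value_join[of s t] val st(1,2) by blast
    then show ?thesis
      using st h join_birooted'[OF st(1,2)] wedge_reduced_form[OF st(1,2)] valI by simp
  qed
  have h_letter: "h (letter x) = f x" if x: "x \<in> X" for x
    unfolding letter_reduced_form[OF x] h[OF letter_edge_birooted[OF x]]
    using has_value_letter_edge[OF x] by (rule valI)
  show ?thesis
  proof (rule ex1I[of _ h])
    show "h \<in> \<AA> X \<rightarrow>\<^sub>E S \<and> (\<forall>\<alpha> \<in> \<AA> X. \<forall>\<beta> \<in> \<AA> X. h (\<alpha> \<and>\<^sub>T \<beta>) = h \<alpha> \<cdot> h \<beta>)
        \<and> (\<forall>x \<in> X. h (letter x) = f x)"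
      by (intro conjI ballI h_fun h_hom h_letter)
  next
    fix g assume g: "g \<in> \<AA> X \<rightarrow>\<^sub>E S \<and> (\<forall>\<alpha> \<in> \<AA> X. \<forall>\<beta> \<in> \<AA> X. g (\<alpha> \<and>\<^sub>T \<beta>) = g \<alpha> \<cdot> g \<beta>)
        \<and> (\<forall>x \<in> X. g (letter x) = f x)"
    have "\<AA> X \<subseteq> {\<alpha>. g \<alpha> = h \<alpha>}"
    proof (rule reduced_trees_generated)
      show "letter ` X \<subseteq> {\<alpha>. g \<alpha> = h \<alpha>}" using g h_letter by auto
      fix \<alpha> \<beta> assume "\<alpha> \<in> \<AA> X" "\<beta> \<in> \<AA> X" "\<alpha> \<in> {\<alpha>. g \<alpha> = h \<alpha>}" "\<beta> \<in> {\<alpha>. g \<alpha> = h \<alpha>}"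
      then show "\<alpha> \<and>\<^sub>T \<beta> \<in> {\<alpha>. g \<alpha> = h \<alpha>}" using g h_hom by simp
    qed
    then show "g = h" using PiE_ext[OF conjunct1[OF g] h_fun] by blast
  qed
qed

theorem theorem3p11:
  fixes X :: "'a set"
  assumes "X \<noteq> {}"
  shows "pseudosemilattice (\<AA> X) (\<and>\<^sub>T)
    \<and> letter ` X \<subseteq> \<AA> X \<and> inj_on letter X
    \<and> (\<forall>(S :: 'b set) mult f. pseudosemilattice S mult \<and> f \<in> X \<rightarrow> S \<longrightarrow>
         (\<exists>!h. h \<in> \<AA> X \<rightarrow>\<^sub>E S
            \<and> (\<forall>\<alpha> \<in> \<AA> X. \<forall>\<beta> \<in> \<AA> X. h (\<alpha> \<and>\<^sub>T \<beta>) = mult (h \<alpha>) (h \<beta>))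
            \<and> (\<forall>x \<in> X. h (letter x) = f x)))"
proof (intro conjI allI impI)
  show "pseudosemilattice (\<AA> X) (\<and>\<^sub>T)" by (rule reduced_trees_pseudosemilattice)
  show "letter ` X \<subseteq> \<AA> X" by (rule letter_in_reduced_trees)
  show "inj_on letter X" using inj_letter by (rule inj_on_subset) simp
next
  fix S :: "'b set" and mult f
  assume "pseudosemilattice S mult \<and> f \<in> X \<rightarrow> S"
  then have "evaluation S mult X f"
    unfolding evaluation_def evaluation_axioms_def by blast
  then show "\<exists>!h. h \<in> \<AA> X \<rightarrow>\<^sub>E S
      \<and> (\<forall>\<alpha> \<in> \<AA> X. \<forall>\<beta> \<in> \<AA> X. h (\<alpha> \<and>\<^sub>T \<beta>) = mult (h \<alpha>) (h \<beta>))
      \<and> (\<forall>x \<in> X. h (letter x) = f x)"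
    by (rule evaluation.universal_property)
qed

end
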